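(* Let $T: M \to M$ be a linear map (not assumed continuous) on a von Neumann algebra $M$. Then the following are equivalent: (i) $T$ is anti-derivable at zero. (ii) There exists an element $\eta$ in the type $I_1$ part of $M$ satisfying $T(a) = \eta a$ for all $a\in M$.
   Context: A linear map $T:M\to M$ is anti-derivable at zero if $T(b) a + b T(a)=0$ whenever $a,b\in M$ and $ab=0$. The type $I_1$ part of $M$ is the (possibly zero) direct summand $p_{I_1}M$ of type $I_1$ in the type decomposition of $M$, where $p_{I_1}$ is a central projection; it is a commutative von Neumann algebra. *)

theory Defs
  imports "HOL-Analysis.Analysis"
begin

section \<open>Complex Hilbert spaces\<close>

class scaleC =
  fixes scaleC :: "complex \<Rightarrow> 'a \<Rightarrow> 'a" (infixr "*\<^sub>C" 75)

class complex_vector = scaleC + ab_group_add +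
  assumes scaleC_add_right: "c *\<^sub>C (x + y) = c *\<^sub>C x + c *\<^sub>C y"
    and scaleC_add_left: "(c + d) *\<^sub>C x = c *\<^sub>C x + d *\<^sub>C x"
    and scaleC_scaleC: "c *\<^sub>C d *\<^sub>C x = (c * d) *\<^sub>C x"
    and scaleC_one: "1 *\<^sub>C x = x"

text \<open>The inner product is linear in the first variable. Positivity and definiteness are
  contained in \<open>cinner_self\<close>; completeness comes from the class \<^class>\<open>banach\<close>.\<close>

class complex_hilbert = complex_vector + banach +
  fixes cinner :: "'a \<Rightarrow> 'a \<Rightarrow> complex"
  assumes scaleR_scaleC: "r *\<^sub>R x = complex_of_real r *\<^sub>C x"
    and cinner_commute: "cinner x y = cnj (cinner y x)"
    and cinner_add_left: "cinner (x + y) z = cinner x z + cinner y z"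
    and cinner_scaleC_left: "cinner (c *\<^sub>C x) y = c * cinner x y"
    and cinner_self: "cinner x x = complex_of_real ((norm x)\<^sup>2)"

lemma norm_scaleC: "norm (c *\<^sub>C (x :: 'h::complex_hilbert)) = cmod c * norm x"
proof -
  have "complex_of_real ((norm (c *\<^sub>C x))\<^sup>2) = c * cinner x (c *\<^sub>C x)"
    by (simp only: cinner_scaleC_left flip: cinner_self)
  also have "cinner x (c *\<^sub>C x) = cnj c * cinner x x"
    by (subst (1 2) cinner_commute) (simp add: cinner_scaleC_left)
  also have "c * (cnj c * cinner x x) = (c * cnj c) * complex_of_real ((norm x)\<^sup>2)"
    by (simp only: cinner_self mult.assoc)
  also have "\<dots> = complex_of_real ((cmod c * norm x)\<^sup>2)"
    by (simp only: complex_norm_square[symmetric] power_mult_distrib of_real_mult of_real_power)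
  finally have "(norm (c *\<^sub>C x))\<^sup>2 = (cmod c * norm x)\<^sup>2"
    using of_real_eq_iff by blast
  then show ?thesis
    by simp
qed

lemma bounded_linear_scaleC: "bounded_linear (\<lambda>x :: 'h::complex_hilbert. c *\<^sub>C x)"
  by (rule bounded_linear_intro[where K = "cmod c"])
    (simp_all add: scaleC_add_right scaleR_scaleC scaleC_scaleC norm_scaleC mult.commute)


section \<open>The algebra of bounded operators\<close>

typedef (overloaded) 'h bounded_op =
  "{f :: 'h::complex_hilbert \<Rightarrow> 'h. bounded_linear f \<and> (\<forall>c x. f (c *\<^sub>C x) = c *\<^sub>C f x)}"
  morphisms op_apply Bounded_op
  by (rule exI[of _ "\<lambda>x. x"]) (simp add: bounded_linear_ident)

setup_lifting type_definition_bounded_op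

lemma scaleC_zero_right: "c *\<^sub>C (0 :: 'a::complex_vector) = 0"
  using scaleC_add_right[of c 0 0] by simp

lemma scaleC_minus_right: "c *\<^sub>C (- x :: 'a::complex_vector) = - (c *\<^sub>C x)"
  using scaleC_add_right[of c x "- x"] by (simp add: scaleC_zero_right eq_neg_iff_add_eq_0 add.commute)

lemma scaleC_diff_right: "c *\<^sub>C (x - y :: 'a::complex_vector) = c *\<^sub>C x - c *\<^sub>C y"
  using scaleC_add_right[of c x "- y"] by (simp add: scaleC_minus_right)

text \<open>The classes \<open>ring\<close> and \<open>monoid_mult\<close> are used rather than \<open>ring_1\<close>, because
  \<open>0 = 1\<close> holds on the zero Hilbert space.\<close>

instantiation bounded_op :: (complex_hilbert) "{complex_vector, ring, monoid_mult}"
begin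

lift_definition zero_bounded_op :: "'a bounded_op" is "\<lambda>x. 0"
  by (simp add: scaleC_zero_right)

lift_definition one_bounded_op :: "'a bounded_op" is "\<lambda>x. x"
  by (simp add: bounded_linear_ident)

lift_definition plus_bounded_op :: "'a bounded_op \<Rightarrow> 'a bounded_op \<Rightarrow> 'a bounded_op"
  is "\<lambda>f g x. f x + g x"
  by (simp add: bounded_linear_add scaleC_add_right)

lift_definition uminus_bounded_op :: "'a bounded_op \<Rightarrow> 'a bounded_op" is "\<lambda>f x. - f x"
  by (simp add: bounded_linear_minus scaleC_minus_right)

lift_definition minus_bounded_op :: "'a bounded_op \<Rightarrow> 'a bounded_op \<Rightarrow> 'a bounded_op"
  is "\<lambda>f g x. f x - g x"
  by (simp add: bounded_linear_sub scaleC_diff_right)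

lift_definition times_bounded_op :: "'a bounded_op \<Rightarrow> 'a bounded_op \<Rightarrow> 'a bounded_op"
  is "\<lambda>f g x. f (g x)"
  by (simp add: bounded_linear_compose)

lift_definition scaleC_bounded_op :: "complex \<Rightarrow> 'a bounded_op \<Rightarrow> 'a bounded_op"
  is "\<lambda>c f x. c *\<^sub>C f x"
  by (simp add: bounded_linear_compose[OF bounded_linear_scaleC] scaleC_scaleC mult.commute)

instance
proof
  fix a b c :: "'a bounded_op" and x y :: complex
  show "a + b + c = a + (b + c)" by transfer (simp add: add.assoc)
  show "a + b = b + a" by transfer (simp add: add.commute)
  show "0 + a = a" by transfer simp
  show "- a + a = 0" by transfer simp
  show "a - b = a + - b" by transfer simp
  show "a * b * c = a * (b * c)" by transfer simp
  show "1 * a = a" by transfer simp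
  show "a * 1 = a" by transfer simp
  show "(a + b) * c = a * c + b * c" by transfer simp
  show "a * (b + c) = a * b + a * c"
    by transfer (metis bounded_linear.linear linear_add)
  show "x *\<^sub>C (a + b) = x *\<^sub>C a + x *\<^sub>C b" by transfer (simp add: scaleC_add_right)
  show "(x + y) *\<^sub>C a = x *\<^sub>C a + y *\<^sub>C a" by transfer (simp add: scaleC_add_left)
  show "x *\<^sub>C y *\<^sub>C a = (x * y) *\<^sub>C a" by transfer (simp add: scaleC_scaleC)
  show "1 *\<^sub>C a = a" by transfer (simp add: scaleC_one)
qed

end

definition is_adjoint :: "'h::complex_hilbert bounded_op \<Rightarrow> 'h bounded_op \<Rightarrow> bool" where
  "is_adjoint a b \<longleftrightarrow> (\<forall>x y. cinner (op_apply a x) y = cinner x (op_apply b y))"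


section \<open>Von Neumann algebras\<close>

definition commutant :: "'h::complex_hilbert bounded_op set \<Rightarrow> 'h bounded_op set" where
  "commutant S = {b. \<forall>a\<in>S. a * b = b * a}"

definition unital_star_subalgebra :: "'h::complex_hilbert bounded_op set \<Rightarrow> bool" where
  "unital_star_subalgebra M \<longleftrightarrow>
     1 \<in> M \<and>
     (\<forall>a\<in>M. \<forall>b\<in>M. a + b \<in> M) \<and>
     (\<forall>c. \<forall>a\<in>M. c *\<^sub>C a \<in> M) \<and>
     (\<forall>a\<in>M. \<forall>b\<in>M. a * b \<in> M) \<and>
     (\<forall>a\<in>M. \<exists>b\<in>M. is_adjoint a b)"

definition von_neumann_algebra :: "'h::complex_hilbert bounded_op set \<Rightarrow> bool" where
  "von_neumann_algebra M \<longleftrightarrow> unital_star_subalgebra M \<and> commutant (commutant M) = M"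


section \<open>The type \<open>I\<^sub>n\<close> parts\<close>

definition projection_in :: "'h::complex_hilbert bounded_op set \<Rightarrow> 'h bounded_op \<Rightarrow> bool" where
  "projection_in M p \<longleftrightarrow> p \<in> M \<and> p * p = p \<and> is_adjoint p p"

definition central_projection :: "'h::complex_hilbert bounded_op set \<Rightarrow> 'h bounded_op \<Rightarrow> bool" where
  "central_projection M p \<longleftrightarrow> projection_in M p \<and> (\<forall>a\<in>M. p * a = a * p)"

definition abelian_projection :: "'h::complex_hilbert bounded_op set \<Rightarrow> 'h bounded_op \<Rightarrow> bool" where
  "abelian_projection M e \<longleftrightarrow> projection_in M e \<and>
     (\<forall>a\<in>M. \<forall>b\<in>M. (e * a * e) * (e * b * e) = (e * b * e) * (e * a * e))"

text \<open>Murray--von Neumann equivalence: \<open>w\<close> is the adjoint of \<open>v\<close>.\<close>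

definition mvn_equivalent ::
  "'h::complex_hilbert bounded_op set \<Rightarrow> 'h bounded_op \<Rightarrow> 'h bounded_op \<Rightarrow> bool" where
  "mvn_equivalent M e f \<longleftrightarrow> (\<exists>v\<in>M. \<exists>w\<in>M. is_adjoint v w \<and> w * v = e \<and> v * w = f)"

text \<open>The direct summand \<open>p M\<close> is of type \<open>I\<^sub>n\<close> or zero: its unit \<open>p\<close> is a sum of \<open>n\<close>
  orthogonal, equivalent, abelian projections. These lie below \<open>p\<close>, and for projections
  below the central projection \<open>p\<close> being abelian or equivalent means the same in \<open>p M\<close> as
  in \<open>M\<close>.\<close>

definition type_I_summand ::
  "'h::complex_hilbert bounded_op set \<Rightarrow> nat \<Rightarrow> 'h bounded_op \<Rightarrow> bool" where
  "type_I_summand M n p \<longleftrightarrow> central_projection M p \<and>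
     (\<exists>e. (\<forall>i<n. abelian_projection M (e i)) \<and>
          (\<forall>i<n. \<forall>j<n. mvn_equivalent M (e i) (e j)) \<and>
          (\<forall>i<n. \<forall>j<n. i \<noteq> j \<longrightarrow> e i * e j = 0) \<and>
          (\<Sum>i<n. e i) = p)"

text \<open>In the type decomposition, the central projection belonging to the type \<open>I\<^sub>n\<close> part is the
  greatest central projection whose summand is of type \<open>I\<^sub>n\<close> or zero; for projections,
  \<open>q \<le> p\<close> means \<open>p q = q\<close>.\<close>

definition type_I_projection :: "'h::complex_hilbert bounded_op set \<Rightarrow> nat \<Rightarrow> 'h bounded_op" where
  "type_I_projection M n =
     (THE p. type_I_summand M n p \<and> (\<forall>q. type_I_summand M n q \<longrightarrow> p * q = q))"

definition type_I_part :: "'h::complex_hilbert bounded_op set \<Rightarrow> nat \<Rightarrow> 'h bounded_op set" where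
  "type_I_part M n = {type_I_projection M n * a | a. a \<in> M}"


section \<open>Linear maps anti-derivable at zero\<close>

definition complex_linear_on :: "'a::complex_vector set \<Rightarrow> ('a \<Rightarrow> 'b::complex_vector) \<Rightarrow> bool" where
  "complex_linear_on M T \<longleftrightarrow>
     (\<forall>a\<in>M. \<forall>b\<in>M. T (a + b) = T a + T b) \<and> (\<forall>c. \<forall>a\<in>M. T (c *\<^sub>C a) = c *\<^sub>C T a)"

definition anti_derivable_at_zero :: "'a::ring set \<Rightarrow> ('a \<Rightarrow> 'a) \<Rightarrow> bool" where
  "anti_derivable_at_zero M T \<longleftrightarrow>
     (\<forall>a\<in>M. \<forall>b\<in>M. a * b = 0 \<longrightarrow> T b * a + b * T a = 0)"

end

theory Submission
  imports Defs
begin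

text \<open>A multiplication by an element \<open>\<eta>\<close> of the commutative central summand is anti-derivable at zero
  because there \<open>a b = 0\<close> implies \<open>b a = 0\<close>. For the converse let \<open>\<delta> = T 1\<close>.

  For an idempotent \<open>g\<close> of \<open>M\<close> the products \<open>(x g) ((1 - g) y)\<close> vanish. Feeding them to \<open>T\<close> shows that
  \<open>\<delta>\<close> commutes with \<open>g\<close> and that \<open>T g = \<delta> g\<close> (\<open>anti_derivable_idempotent\<close>). Applied to a projection \<open>e\<close> and to
  the skew idempotents \<open>e + e x (1 - e)\<close>, this gives \<open>T (e x) = e T x\<close> and \<open>\<delta> (e x - x e) = 0\<close>
  (\<open>anti_derivable_projection\<close>).

  The analytic core is \<open>projection_linear_is_right_multiplication\<close>: a linear map \<open>L\<close> on \<open>M\<close> with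
  \<open>L (e x) = e L x\<close> for all projections \<open>e\<close> is \<open>x \<mapsto> x L 1\<close>, and in particular automatically continuous.
  Applied to \<open>T\<close>, to \<open>x \<mapsto> \<delta> x\<close> and to \<open>x \<mapsto> \<delta> (x y - y x)\<close> it shows that \<open>T x = x \<delta>\<close>, that \<open>\<delta>\<close> is
  central, and that \<open>\<delta>\<close> kills all commutators. The greatest commutative central summand is the
  complement of the one generated by the commutators (\<open>greatest_commutative_summand\<close>), so \<open>\<delta>\<close> lies
  in it.

  The core lemma needs projections along which a self-adjoint \<open>y\<close> is nearly scalar. They are obtained
  by repeated bisection with the range projection of \<open>\<bar>x\<bar> + x\<close>, where \<open>\<bar>x\<bar>\<close> is a square root of \<open>x\<^sup>2\<close>;
  range projections lie in \<open>M\<close> by the double commutant property (\<open>range_projection\<close>). A gliding hump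
  argument along such a sequence replaces continuity.\<close>

section \<open>The inner product and orthogonal projections\<close>

lemma cinner_scaleC_right: "cinner (x :: 'h::complex_hilbert) (c *\<^sub>C y) = cnj c * cinner x y"
  by (subst (1 2) cinner_commute) (simp add: cinner_scaleC_left)

lemma cinner_add_right: "cinner (x :: 'h::complex_hilbert) (y + z) = cinner x y + cinner x z"
  by (subst (1 2 3) cinner_commute) (simp add: cinner_add_left)

lemma norm_sq_cinner: "(norm (x :: 'h::complex_hilbert))\<^sup>2 = Re (cinner x x)"
  by (simp add: cinner_self del: of_real_power)

lemma norm_add_sq: "(norm ((x :: 'h::complex_hilbert) + y))\<^sup>2 = (norm x)\<^sup>2 + (norm y)\<^sup>2 + 2 * Re (cinner x y)"
  using cinner_commute[of y x] by (simp add: norm_sq_cinner cinner_add_left cinner_add_right)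

lemma Re_cinner_le: "Re (cinner (x :: 'h::complex_hilbert) y) \<le> norm x * norm y"
proof -
  have "(norm (x + y))\<^sup>2 \<le> (norm x + norm y)\<^sup>2"
    by (simp add: norm_triangle_ineq power_mono)
  then show ?thesis
    by (simp add: norm_add_sq power2_sum)
qed

lemma norm_cinner_le: "cmod (cinner (x :: 'h::complex_hilbert) y) \<le> norm x * norm y"
proof (cases "cinner x y = 0")
  case False
  define c where "c = cnj (sgn (cinner x y))"
  have "cmod c = 1" using False by (simp add: c_def norm_sgn)
  have "c * cinner x y = complex_of_real (cmod (cinner x y))"
  proof -
    have "cnj (cinner x y) * cinner x y = complex_of_real (cmod (cinner x y) * cmod (cinner x y))"
      using complex_norm_square[of "cinner x y"] by (simp add: power2_eq_square mult.commute)
    then show ?thesis using False by (simp add: c_def sgn_eq)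
  qed
  then have "cmod (cinner x y) = Re (cinner (c *\<^sub>C x) y)"
    by (simp add: cinner_scaleC_left)
  also have "\<dots> \<le> norm x * norm y"
    using Re_cinner_le[of "c *\<^sub>C x" y] \<open>cmod c = 1\<close> by (simp add: norm_scaleC)
  finally show ?thesis .
qed simp

lemma bounded_bilinear_cinner: "bounded_bilinear (cinner :: 'h::complex_hilbert \<Rightarrow> _)"
proof (rule bounded_bilinear.intro)
  show "\<exists>K. \<forall>a b. cmod (cinner (a::'h) b) \<le> norm a * norm b * K"
    by (rule exI[of _ 1]) (simp add: norm_cinner_le)
qed (simp_all add: cinner_add_left cinner_add_right scaleR_scaleC cinner_scaleC_left
    cinner_scaleC_right scaleR_conv_of_real)

lemmas cinner_diff_left = bounded_bilinear.diff_left[OF bounded_bilinear_cinner]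
  and cinner_diff_right = bounded_bilinear.diff_right[OF bounded_bilinear_cinner]
  and cinner_zero_left = bounded_bilinear.zero_left[OF bounded_bilinear_cinner]
  and cinner_zero_right = bounded_bilinear.zero_right[OF bounded_bilinear_cinner]
  and tendsto_cinner = bounded_bilinear.tendsto[OF bounded_bilinear_cinner]

lemma cinner_eq_all: 
  assumes "\<And>z :: 'h::complex_hilbert. cinner x z = cinner y z" shows "x = y"
proof -
  have "cinner (x - y) (x - y) = 0" using assms[of "x - y"] by (simp add: cinner_diff_left)
  then show ?thesis by (simp add: cinner_self)
qed

text \<open>By the parallelogram law any minimizing sequence for the distance is a Cauchy sequence.\<close>
lemma closest_point_exists:
  fixes V :: "'h::complex_hilbert set"
  assumes V: "subspace V" "closed V"
  shows "\<exists>v\<in>V. \<forall>u\<in>V. norm (\<xi> - v) \<le> norm (\<xi> - u)"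
proof -
  define d where "d = infdist \<xi> V"
  have ne: "V \<noteq> {}" using subspace_0[OF V(1)] by blast
  have le: "d \<le> norm (\<xi> - u)" if "u \<in> V" for u
    using infdist_le[OF that, of \<xi>] by (simp add: d_def dist_norm)
  have d0: "0 \<le> d" by (simp add: d_def infdist_nonneg)
  have "\<exists>v\<in>V. norm (\<xi> - v) < d + 1 / Suc n" for n
  proof (rule ccontr)
    assume "\<not> ?thesis"
    then have "d + 1 / Suc n \<le> infdist \<xi> V"
      unfolding infdist_notempty[OF ne] by (intro cINF_greatest[OF ne]) (auto simp: dist_norm not_less)
    then show False by (simp add: d_def)
  qed
  then obtain v where vV: "\<And>n. v n \<in> V" and v: "\<And>n. norm (\<xi> - v n) < d + 1 / Suc n" 
    by metis
  have main: "(norm (v m - v n))\<^sup>2 \<le> 4 * ((d + 1 / Suc N)\<^sup>2 - d\<^sup>2)" if "m \<ge> N" "n \<ge> N" for m n N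
  proof -
    have b: "(norm (\<xi> - v k))\<^sup>2 \<le> (d + 1 / Suc N)\<^sup>2" if "k \<ge> N" for k
    proof (rule power_mono)
      have "1 / real (Suc k) \<le> 1 / Suc N" using that by (simp add: frac_le)
      then show "norm (\<xi> - v k) \<le> d + 1 / Suc N" using v[of k] by linarith
    qed simp
    define h where "h = \<xi> - (1/2) *\<^sub>R (v m + v n)"
    have "(1/2) *\<^sub>R (v m + v n) \<in> V" using vV V(1) by (simp add: subspace_add subspace_scale)
    then have "d\<^sup>2 \<le> (norm h)\<^sup>2" unfolding h_def using le d0 by (intro power_mono) auto
    moreover have "(norm (v m - v n))\<^sup>2 = 2 * (norm (\<xi> - v m))\<^sup>2 + 2 * (norm (\<xi> - v n))\<^sup>2 - 4 * (norm h)\<^sup>2"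
    proof -
      have 2: "(2::real) *\<^sub>R h = (\<xi> - v m) + (\<xi> - v n)" by (simp add: h_def scaleR_diff_right scaleR_2)
      have "4 * (norm h)\<^sup>2 = (norm ((2::real) *\<^sub>R h))\<^sup>2" by (simp add: power_mult_distrib)
      also have "\<dots> = (norm (\<xi> - v m))\<^sup>2 + (norm (\<xi> - v n))\<^sup>2 + 2 * Re (cinner (\<xi> - v m) (\<xi> - v n))"
        unfolding 2 by (rule norm_add_sq)
      finally have 3: "4 * (norm h)\<^sup>2 = \<dots>" .
      have "v m - v n = (\<xi> - v n) + (- (\<xi> - v m))" by simp
      then have "(norm (v m - v n))\<^sup>2 = (norm (\<xi> - v n))\<^sup>2 + (norm (\<xi> - v m))\<^sup>2 + 2 * Re (cinner (\<xi> - v n) (- (\<xi> - v m)))"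
        using norm_add_sq[of "\<xi> - v n" "- (\<xi> - v m)"] by (simp add: norm_minus_commute)
      moreover have "Re (cinner (\<xi> - v n) (- (\<xi> - v m))) = - Re (cinner (\<xi> - v m) (\<xi> - v n))"
        by (subst cinner_commute) (simp add: bounded_bilinear.minus_left[OF bounded_bilinear_cinner] del: minus_diff_eq)
      ultimately show ?thesis using 3 by linarith
    qed
    moreover have "A \<le> 4 * (B - D)" if "D \<le> H" "A = 2 * x + 2 * y - 4 * H" "x \<le> B" "y \<le> B" for A B D H x y :: real
      using that by simp
    ultimately show ?thesis using b[OF that(1)] b[OF that(2)] by blast
  qed
  have "(\<lambda>N. 4 * ((d + 1 / Suc N)\<^sup>2 - d\<^sup>2)) \<longlonglongrightarrow> 4 * ((d + 0)\<^sup>2 - d\<^sup>2)"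
    by (intro tendsto_intros LIMSEQ_Suc[OF lim_1_over_n])
  then have lim: "(\<lambda>N. 4 * ((d + 1 / Suc N)\<^sup>2 - d\<^sup>2)) \<longlonglongrightarrow> 0" by simp
  have "Cauchy v"
  proof (rule metric_CauchyI)
    fix e :: real assume "0 < e"
    then have "eventually (\<lambda>N. 4 * ((d + 1 / Suc N)\<^sup>2 - d\<^sup>2) < e\<^sup>2) sequentially"
      using order_tendstoD(2)[OF lim, of "e\<^sup>2"] by simp
    then obtain N where N: "4 * ((d + 1 / Suc N)\<^sup>2 - d\<^sup>2) < e\<^sup>2"
      unfolding eventually_sequentially by blast
    show "\<exists>M. \<forall>m\<ge>M. \<forall>n\<ge>M. dist (v m) (v n) < e"
    proof (intro exI allI impI)
      fix m n assume "m \<ge> N" "n \<ge> N"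
      then have "(norm (v m - v n))\<^sup>2 < e\<^sup>2" using main[of N m n] N by linarith
      then show "dist (v m) (v n) < e" using \<open>0 < e\<close> by (simp add: dist_norm power_less_imp_less_base)
    qed
  qed
  then obtain l where l: "v \<longlonglongrightarrow> l" using Cauchy_convergent convergent_def by blast
  have "l \<in> V" using closed_sequentially[OF V(2)] vV l by blast
  have "norm (\<xi> - l) \<le> d + 0"
  proof (rule LIMSEQ_le)
    show "(\<lambda>n. norm (\<xi> - v n)) \<longlonglongrightarrow> norm (\<xi> - l)" by (intro tendsto_intros l)
    show "(\<lambda>n. d + 1 / Suc n) \<longlonglongrightarrow> d + 0" by (intro tendsto_intros LIMSEQ_Suc[OF lim_1_over_n])
    show "\<exists>N. \<forall>n\<ge>N. norm (\<xi> - v n) \<le> d + 1 / Suc n" using v less_imp_le by blast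
  qed
  then show ?thesis using \<open>l \<in> V\<close> le by (metis add.right_neutral order_trans)
qed

text \<open>Moving the closest point along a direction of \<open>V\<close> cannot decrease the distance, so the
  first-order term, which is the real part of the inner product, vanishes; multiplying the direction
  by \<open>\<i>\<close> kills the imaginary part.\<close>
lemma orthogonal_part_exists:
  fixes V :: "'h::complex_hilbert set"
  assumes V: "subspace V" "closed V" and C: "\<And>c v. v \<in> V \<Longrightarrow> c *\<^sub>C v \<in> V"
  shows "\<exists>v\<in>V. \<forall>u\<in>V. cinner (\<xi> - v) u = 0"
proof -
  obtain v where v: "v \<in> V" "\<And>u. u \<in> V \<Longrightarrow> norm (\<xi> - v) \<le> norm (\<xi> - u)"
    using closest_point_exists[OF V, of \<xi>] by blast
  have Re0: "Re (cinner (\<xi> - v) u) = 0" if u: "u \<in> V" for u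
  proof -
    define \<rho> where "\<rho> = Re (cinner (\<xi> - v) u)"
    \<comment> \<open>Any step of the sign of \<open>\<rho>\<close> and small compared with \<open>\<rho>\<close> contradicts minimality unless \<open>\<rho> = 0\<close>.\<close>
    define t where "t = \<rho> / ((norm u)\<^sup>2 + 1)"
    have pos: "(norm u)\<^sup>2 + 1 > 0" by (simp add: add_nonneg_pos)
    have "v + t *\<^sub>R u \<in> V" using V(1) v(1) u by (simp add: subspace_add subspace_scale)
    then have "(norm (\<xi> - v))\<^sup>2 \<le> (norm (\<xi> - (v + t *\<^sub>R u)))\<^sup>2" using v(2) by (simp add: power_mono)
    also have "\<xi> - (v + t *\<^sub>R u) = (\<xi> - v) + (- t) *\<^sub>R u" by simp
    also have "(norm \<dots>)\<^sup>2 = (norm (\<xi> - v))\<^sup>2 + t\<^sup>2 * (norm u)\<^sup>2 - 2 * t * \<rho>"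
      unfolding norm_add_sq \<rho>_def
      by (simp add: bounded_bilinear.scaleR_right[OF bounded_bilinear_cinner] bounded_bilinear.minus_right[OF bounded_bilinear_cinner] power_mult_distrib)
    finally have 1: "2 * t * \<rho> \<le> t\<^sup>2 * (norm u)\<^sup>2" by simp
    have "t * ((norm u)\<^sup>2 + 1) = \<rho>" using pos by (simp add: t_def)
    then have "2 * t\<^sup>2 * ((norm u)\<^sup>2 + 1) \<le> t\<^sup>2 * (norm u)\<^sup>2"
      using 1 by (metis (no_types, lifting) mult.assoc mult.left_commute power2_eq_square)
    then have "t\<^sup>2 * ((norm u)\<^sup>2 + 2) \<le> 0" by (simp add: algebra_simps)
    then have "t = 0" by (simp add: mult_le_0_iff) (smt (verit) zero_le_power2)
    then show ?thesis using pos by (simp add: t_def \<rho>_def)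
  qed
  have "cinner (\<xi> - v) u = 0" if "u \<in> V" for u
  proof (rule complex_eqI)
    have "Re (cinner (\<xi> - v) (\<i> *\<^sub>C u)) = 0" using Re0 C that by blast
    then show "Im (cinner (\<xi> - v) u) = Im 0" by (simp add: cinner_scaleC_right)
  qed (use Re0 that in simp)
  then show ?thesis using v(1) by blast
qed

section \<open>Bounded operators and adjoints\<close>

lemma op_apply_simps:
  "op_apply (a + b) x = op_apply a x + op_apply b x"
  "op_apply (a - b) x = op_apply a x - op_apply b x"
  "op_apply (- a) x = - op_apply a x"
  "op_apply (a * b) x = op_apply a (op_apply b x)"
  "op_apply 0 x = 0" "op_apply 1 x = x" "op_apply (c *\<^sub>C a) x = c *\<^sub>C op_apply a x"
  by (transfer; simp)+

lemma bounded_op_eqI: "(\<And>x. op_apply a x = op_apply b x) \<Longrightarrow> a = b"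
  by transfer auto

lemma bounded_linear_op: "bounded_linear (op_apply a)" and op_scaleC: "op_apply a (c *\<^sub>C x) = c *\<^sub>C op_apply a x"
  by (transfer; simp)+

lemmas op_add = linear_add[OF bounded_linear.linear[OF bounded_linear_op]]
  and op_diff = linear_diff[OF bounded_linear.linear[OF bounded_linear_op]]
  and op_zero = linear_0[OF bounded_linear.linear[OF bounded_linear_op]]
  and tendsto_op = bounded_linear.tendsto[OF bounded_linear_op]

lemma subspace_closure:
  fixes S :: "'a::real_normed_vector set"
  assumes "subspace S" shows "subspace (closure S)"
  unfolding subspace_def
proof (intro conjI ballI allI)
  show "0 \<in> closure S" using subspace_0[OF assms] closure_subset by blast
next
  fix x y assume "x \<in> closure S" "y \<in> closure S"
  then obtain f g where "\<And>n. f n \<in> S" "f \<longlonglongrightarrow> x" "\<And>n. g n \<in> S" "g \<longlonglongrightarrow> y"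
    unfolding closure_sequential by blast
  then have "\<And>n. f n + g n \<in> S" "(\<lambda>n. f n + g n) \<longlonglongrightarrow> x + y"
    using assms by (auto simp: subspace_add intro: tendsto_add)
  then show "x + y \<in> closure S" unfolding closure_sequential by (intro exI[of _ "\<lambda>n. f n + g n"]) blast
next
  fix c x assume "x \<in> closure S"
  then obtain f where "\<And>n. f n \<in> S" "f \<longlonglongrightarrow> x"
    unfolding closure_sequential by blast
  then have "\<And>n. c *\<^sub>R f n \<in> S" "(\<lambda>n. c *\<^sub>R f n) \<longlonglongrightarrow> c *\<^sub>R x"
    using assms by (auto simp: subspace_scale intro: tendsto_intros)
  then show "c *\<^sub>R x \<in> closure S" unfolding closure_sequential by (intro exI[of _ "\<lambda>n. c *\<^sub>R f n"]) blast
qed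

text \<open>Closure of \<open>G\<close> under complex scalars makes the real span a complex subspace, so the nearest
  point in it is also the orthogonal projection for the complex inner product.\<close>
lemma projection_onto_closed_span:
  fixes G :: "'h::complex_hilbert set"
  assumes G: "\<And>c g. g \<in> G \<Longrightarrow> c *\<^sub>C g \<in> G"
  obtains P where "is_adjoint P P" "\<And>x. op_apply P x \<in> closure (span G)"
    "\<And>v. v \<in> closure (span G) \<Longrightarrow> op_apply P v = v"
proof -
  define V where "V = closure (span G)"
  have V: "subspace V" "closed V" by (simp_all add: V_def subspace_closure)
  have C: "c *\<^sub>C v \<in> V" if "v \<in> V" for c v
  proof -
    have "(*\<^sub>C) c ` closure (span G) \<subseteq> closure ((*\<^sub>C) c ` span G)"
      by (rule closure_bounded_linear_image_subset[OF bounded_linear_scaleC])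
    also have "(*\<^sub>C) c ` span G = span ((*\<^sub>C) c ` G)"
      by (rule linear_span_image[symmetric]) (simp add: bounded_linear.linear bounded_linear_scaleC)
    also have "closure \<dots> \<subseteq> V" unfolding V_def using G by (intro closure_mono span_mono) auto
    finally show ?thesis using that by (auto simp: V_def)
  qed
  define p where "p x = (SOME v. v \<in> V \<and> (\<forall>u\<in>V. cinner (x - v) u = 0))" for x
  have p: "p x \<in> V \<and> (\<forall>u\<in>V. cinner (x - p x) u = 0)" for x
    unfolding p_def by (rule someI_ex) (use orthogonal_part_exists[OF V C, of x] in blast)
  have uniq: "p x = v" if "v \<in> V" "\<And>u. u \<in> V \<Longrightarrow> cinner (x - v) u = 0" for x v
  proof -
    have "p x - v \<in> V" using p that(1) V(1) by (simp add: subspace_diff)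
    then have "cinner ((x - v) - (x - p x)) (p x - v) = 0"
      using p that(2) by (simp only: cinner_diff_left[of "x - v"]) simp
    then have "cinner (p x - v) (p x - v) = 0" by simp
    then show ?thesis by (simp add: cinner_self)
  qed
  have bl: "bounded_linear p"
  proof (rule bounded_linear_intro)
    fix x y :: 'h and r :: real
    show "p (x + y) = p x + p y"
    proof (rule uniq)
      fix u assume "u \<in> V"
      then have "cinner ((x - p x) + (y - p y)) u = 0" using p by (simp only: cinner_add_left) simp
      then show "cinner (x + y - (p x + p y)) u = 0" by (simp only: add_diff_add)
    qed (use p V(1) in \<open>simp add: subspace_add\<close>)
    show "p (r *\<^sub>R x) = r *\<^sub>R p x"
    proof (rule uniq)
      fix u assume "u \<in> V"
      then show "cinner (r *\<^sub>R x - r *\<^sub>R p x) u = 0" using p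
        by (simp add: bounded_bilinear.scaleR_left[OF bounded_bilinear_cinner] flip: scaleR_diff_right)
    qed (use p V(1) in \<open>simp add: subspace_scale\<close>)
    have "(norm x)\<^sup>2 = (norm ((x - p x) + p x))\<^sup>2" by simp
    also have "\<dots> = (norm (x - p x))\<^sup>2 + (norm (p x))\<^sup>2" unfolding norm_add_sq using p by simp
    finally have "(norm (p x))\<^sup>2 \<le> (norm x)\<^sup>2" by simp
    then show "norm (p x) \<le> norm x * 1" using power2_le_imp_le[of "norm (p x)" "norm x"] by simp
  qed
  have sc: "p (c *\<^sub>C x) = c *\<^sub>C p x" for c x
    using p C by (intro uniq) (auto simp: cinner_scaleC_left simp flip: scaleC_diff_right)
  have app: "op_apply (Bounded_op p) = p" using bl sc by (simp add: Bounded_op_inverse)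
  show ?thesis
  proof (rule that[of "Bounded_op p"])
    show "is_adjoint (Bounded_op p) (Bounded_op p)" unfolding is_adjoint_def app
    proof (intro allI)
      fix x y
      have "cinner (y - p y) (p x) = 0" "cinner (x - p x) (p y) = 0" using p by auto
      moreover from this(1) have "cinner (p x) (y - p y) = 0" by (subst cinner_commute) simp
      ultimately show "cinner (p x) y = cinner x (p y)" by (simp add: cinner_diff_left cinner_diff_right)
    qed
    show "op_apply (Bounded_op p) x \<in> closure (span G)" for x using p app V_def by auto
    show "op_apply (Bounded_op p) v = v" if "v \<in> closure (span G)" for v
      unfolding app using that by (intro uniq) (auto simp: V_def cinner_zero_left)
  qed
qed

lemma scaleC_minus_left: "(- c) *\<^sub>C (x :: 'a::complex_vector) = - (c *\<^sub>C x)"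
  using scaleC_add_left[of c "- c" x] scaleC_add_left[of 0 0 x] by (simp add: eq_neg_iff_add_eq_0 add.commute)

lemma scaleC_mult:
  fixes a b :: "'h::complex_hilbert bounded_op"
  shows "(c *\<^sub>C a) * b = c *\<^sub>C (a * b)" "a * (c *\<^sub>C b) = c *\<^sub>C (a * b)"
  by (rule bounded_op_eqI; simp add: op_apply_simps op_scaleC)+

lemma op_scaleR: "op_apply a (r *\<^sub>R x) = r *\<^sub>R op_apply a x"
  by (simp add: scaleR_scaleC op_scaleC)

lemma op_apply_of_real: "op_apply (complex_of_real r *\<^sub>C a) x = r *\<^sub>R op_apply a x"
  by (simp add: op_apply_simps scaleR_scaleC)

lemma op_apply_sum: "op_apply (sum f A) x = (\<Sum>i\<in>A. op_apply (f i) x)"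
  by (induction A rule: infinite_finite_induct) (simp_all add: op_apply_simps)

lemma is_adjointD: "is_adjoint a b \<Longrightarrow> cinner (op_apply a x) y = cinner x (op_apply b y)"
  by (simp add: is_adjoint_def)

lemma is_adjoint_sym: "is_adjoint a b \<Longrightarrow> is_adjoint b a"
  unfolding is_adjoint_def by (metis cinner_commute)

lemma is_adjoint_unique:
  assumes "is_adjoint a b" "is_adjoint a c" shows "b = c"
proof (rule bounded_op_eqI, rule cinner_eq_all)
  fix x z
  show "cinner (op_apply b x) z = cinner (op_apply c x) z"
    using assms is_adjointD[OF is_adjoint_sym] by metis
qed

lemma is_adjoint_add: "is_adjoint a b \<Longrightarrow> is_adjoint c d \<Longrightarrow> is_adjoint (a + c) (b + d)"
  and is_adjoint_diff: "is_adjoint a b \<Longrightarrow> is_adjoint c d \<Longrightarrow> is_adjoint (a - c) (b - d)"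
  and is_adjoint_mult: "is_adjoint a b \<Longrightarrow> is_adjoint c d \<Longrightarrow> is_adjoint (a * c) (d * b)"
  and is_adjoint_scaleC: "is_adjoint a b \<Longrightarrow> is_adjoint (k *\<^sub>C a) (cnj k *\<^sub>C b)"
  and is_adjoint_one: "is_adjoint 1 1"
  by (simp_all add: is_adjoint_def op_apply_simps cinner_add_left cinner_add_right cinner_diff_left
      cinner_diff_right cinner_scaleC_left cinner_scaleC_right)

lemma is_adjoint_zero: "is_adjoint 0 0"
  by (simp add: is_adjoint_def op_apply_simps cinner_zero_left cinner_zero_right)

lemma is_adjoint_of_real: "is_adjoint a a \<Longrightarrow> is_adjoint (complex_of_real r *\<^sub>C a) (complex_of_real r *\<^sub>C a)"
  using is_adjoint_scaleC[of a a "complex_of_real r"] by simp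

lemma adjoint_square_zero:
  assumes "is_adjoint u v" "v * u = 0" shows "u = 0"
proof (rule bounded_op_eqI)
  fix x
  have "cinner (op_apply u x) (op_apply u x) = cinner x (op_apply (v * u) x)"
    using is_adjointD[OF assms(1)] by (simp add: op_apply_simps)
  then show "op_apply u x = op_apply 0 x"
    by (simp add: assms(2) op_apply_simps cinner_zero_right cinner_self)
qed

text \<open>Here \<open>P\<close> is the range projection of \<open>x\<close>, described by left annihilators. An operator
  commuting with \<open>x\<close> leaves the range of \<open>x\<close> invariant; a self-adjoint one then leaves its
  orthogonal complement invariant as well.\<close>
lemma commutes_with_range:
  assumes P: "is_adjoint P P" "P * x = x" "\<And>c. c * x = 0 \<Longrightarrow> c * P = 0"
    and b: "is_adjoint b b" "b * x = x * b"
  shows "b * P = P * b"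
proof -
  have "(b - P * b) * x = b * x - P * (b * x)" by (simp add: algebra_simps)
  also have "\<dots> = x * b - (P * x) * b" by (simp only: b(2) mult.assoc)
  finally have "(b - P * b) * x = 0" by (simp add: P(2))
  then have "(b - P * b) * P = 0" by (rule P(3))
  then have e: "b * P = P * b * P" by (simp add: algebra_simps)
  have "is_adjoint (b * P) (P * b)" "is_adjoint (P * b * P) (P * b * P)"
    using is_adjoint_mult[OF b(1) P(1)] is_adjoint_mult[OF is_adjoint_mult[OF P(1) b(1)] P(1)]
    by (simp_all add: mult.assoc)
  then show ?thesis using e is_adjoint_unique by metis
qed

lemma norm_projection_split:
  assumes "P * P = P" "is_adjoint P P"
  shows "(norm x)\<^sup>2 = (norm (op_apply P x))\<^sup>2 + (norm (op_apply (1 - P) x))\<^sup>2"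
proof -
  have "op_apply P (op_apply (1 - P) x) = 0"
    using assms(1) by (metis op_apply_simps(4,5) right_diff_distrib mult_1_right diff_self)
  then have "cinner (op_apply P x) (op_apply (1 - P) x) = 0"
    using is_adjointD[OF assms(2)] by (simp add: cinner_zero_right)
  then show ?thesis
    using norm_add_sq[of "op_apply P x" "op_apply (1 - P) x"] by (simp add: op_apply_simps)
qed

lemma norm_projection_le:
  assumes "P * P = P" "is_adjoint P P"
  shows "norm (op_apply P x) \<le> norm x"
proof -
  have "(norm (op_apply P x))\<^sup>2 \<le> (norm x)\<^sup>2" using norm_projection_split[OF assms, of x] by simp
  then show ?thesis using power2_le_imp_le norm_ge_zero by blast
qed

text \<open>Pointwise convergence of operators is all that is needed below, so no operator norm is
  introduced: the estimate with \<open>B n\<close> stands for a bound on the norm of \<open>a n\<close>.\<close>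
lemma operator_series:
  fixes a :: "nat \<Rightarrow> 'h::complex_hilbert bounded_op"
  assumes a: "\<And>n x. norm (op_apply (a n) x) \<le> B n * norm x" and B: "summable B"
  obtains w where "\<And>x. (\<lambda>n. op_apply (a n) x) sums op_apply w x"
proof -
  define f where "f x = (\<Sum>n. op_apply (a n) x)" for x
  have sB: "summable (\<lambda>n. B n * norm x)" for x :: 'h using B by (rule summable_mult2)
  have s: "summable (\<lambda>n. op_apply (a n) x)" for x
    by (rule summable_comparison_test'[OF sB]) (rule a)
  have bl: "bounded_linear f"
  proof (rule bounded_linear_intro)
    show "f (x + y) = f x + f y" for x y
      unfolding f_def by (simp add: op_add suminf_add[OF s s])
    show "f (r *\<^sub>R x) = r *\<^sub>R f x" for r x
      unfolding f_def by (simp add: op_scaleR suminf_scaleR_right[OF s])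
    show "norm (f x) \<le> norm x * suminf B" for x
    proof -
      have "norm (f x) \<le> (\<Sum>n. B n * norm x)" unfolding f_def by (rule norm_suminf_le[OF a sB])
      also have "\<dots> = norm x * suminf B" using suminf_mult2[OF B, of "norm x"] by (simp add: mult.commute)
      finally show ?thesis .
    qed
  qed
  have sc: "f (c *\<^sub>C x) = c *\<^sub>C f x" for c x
    unfolding f_def by (simp add: op_scaleC bounded_linear.suminf[OF bounded_linear_scaleC s])
  have "op_apply (Bounded_op f) = f" using bl sc by (simp add: Bounded_op_inverse)
  then show ?thesis using that[of "Bounded_op f"] summable_sums[OF s] by (simp add: f_def)
qed

lemma limit_commutes:
  assumes "\<And>x. (\<lambda>n. op_apply (s n) x) \<longlonglongrightarrow> op_apply w x" and "\<And>n :: nat. b * s n = s n * b"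
  shows "b * w = w * b"
proof (rule bounded_op_eqI)
  fix x
  have "(\<lambda>n. op_apply b (op_apply (s n) x)) \<longlonglongrightarrow> op_apply b (op_apply w x)"
    by (rule tendsto_op[OF assms(1)])
  moreover have "op_apply b (op_apply (s n) x) = op_apply (s n) (op_apply b x)" for n
    using assms(2)[of n] by (metis op_apply_simps(4))
  ultimately show "op_apply (b * w) x = op_apply (w * b) x"
    using LIMSEQ_unique[OF _ assms(1)[of "op_apply b x"]] by (simp add: op_apply_simps)
qed

lemma limit_selfadjoint:
  assumes "\<And>x. (\<lambda>n. op_apply (s n) x) \<longlonglongrightarrow> op_apply w x" and "\<And>n :: nat. is_adjoint (s n) (s n)"
  shows "is_adjoint w w"
  unfolding is_adjoint_def
proof (intro allI)
  fix x y
  have "(\<lambda>n. cinner (op_apply (s n) x) y) \<longlonglongrightarrow> cinner (op_apply w x) y"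
    by (intro tendsto_cinner assms(1) tendsto_const)
  moreover have "(\<lambda>n. cinner (op_apply (s n) x) y) \<longlonglongrightarrow> cinner x (op_apply w y)"
    unfolding is_adjointD[OF assms(2)] by (intro tendsto_cinner assms(1) tendsto_const)
  ultimately show "cinner (op_apply w x) y = cinner x (op_apply w y)" by (rule LIMSEQ_unique)
qed

section \<open>Square roots and absolute values\<close>

text \<open>If \<open>w\<close> is a fixed point of \<open>w \<mapsto> (z + w\<^sup>2) / 2\<close>, then \<open>(1 - w)\<^sup>2 = 1 - z\<close>. The iteration from \<open>0\<close>
  consists of polynomials in \<open>z\<close> with nonnegative coefficients, and so do its increments; hence both
  are dominated by the same iteration for the number \<open>z = 1\<close>, which is bounded by \<open>1\<close>. This gives
  a square root of \<open>1 - z\<close> for every \<open>z\<close> of norm at most \<open>1\<close>, without spectral theory.\<close>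
primrec sqrt_iter :: "'h::complex_hilbert bounded_op \<Rightarrow> nat \<Rightarrow> 'h bounded_op" where
  "sqrt_iter z 0 = 0"
| "sqrt_iter z (Suc n) = complex_of_real (1/2) *\<^sub>C (z + sqrt_iter z n * sqrt_iter z n)"

primrec sqrt_bound :: "nat \<Rightarrow> real" where
  "sqrt_bound 0 = 0"
| "sqrt_bound (Suc n) = (1 + (sqrt_bound n)\<^sup>2) / 2"

lemma sqrt_bound_range: "0 \<le> sqrt_bound n \<and> sqrt_bound n \<le> 1"
  by (induction n) (auto simp: power_le_one add_nonneg_nonneg)

lemma sqrt_iter_norm:
  assumes "\<And>x. norm (op_apply z x) \<le> norm x"
  shows "norm (op_apply (sqrt_iter z n) x) \<le> sqrt_bound n * norm x"
proof (induction n arbitrary: x)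
  case (Suc n)
  let ?s = "op_apply (sqrt_iter z n)"
  have "norm (?s (?s x)) \<le> sqrt_bound n * norm (?s x)" by (rule Suc)
  also have "\<dots> \<le> sqrt_bound n * (sqrt_bound n * norm x)"
    using Suc sqrt_bound_range by (intro mult_left_mono) auto
  finally have "norm (op_apply z x + ?s (?s x)) \<le> norm x + (sqrt_bound n)\<^sup>2 * norm x"
    using assms[of x] norm_triangle_ineq[of "op_apply z x" "?s (?s x)"] by (simp add: power2_eq_square)
  moreover have "op_apply (sqrt_iter z (Suc n)) x = (1/2) *\<^sub>R (op_apply z x + ?s (?s x))"
    by (simp only: sqrt_iter.simps op_apply_of_real op_apply_simps(1,4))
  ultimately show ?case by (simp add: distrib_right)
qed (simp add: op_apply_simps)

lemma sqrt_iter_step: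
  assumes "\<And>x. norm (op_apply z x) \<le> norm x"
  shows "norm (op_apply (sqrt_iter z (Suc n) - sqrt_iter z n) x) \<le> (sqrt_bound (Suc n) - sqrt_bound n) * norm x"
proof (induction n arbitrary: x)
  case 0
  have "norm (op_apply (complex_of_real (1/2) *\<^sub>C z) x) \<le> 1/2 * norm x"
    using assms[of x] by (simp add: op_apply_of_real del: of_real_divide)
  then show ?case by simp
next
  case (Suc n)
  define s where "s = sqrt_iter z n"
  define s' where "s' = sqrt_iter z (Suc n)"
  define t where "t = sqrt_bound n"
  define t' where "t' = sqrt_bound (Suc n)"
  have tt: "0 \<le> t" "0 \<le> t'" unfolding t_def t'_def using sqrt_bound_range by blast+
  have st: "norm (op_apply s x) \<le> t * norm x" "norm (op_apply s' x) \<le> t' * norm x" for x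
    unfolding s_def s'_def t_def t'_def by (rule sqrt_iter_norm[OF assms])+
  have IH: "norm (op_apply (s' - s) x) \<le> (t' - t) * norm x" for x
    using Suc unfolding s_def s'_def t_def t'_def .
  have td: "(t' - t) * norm y \<ge> 0" for y :: 'a using IH[of y] norm_ge_zero order_trans by blast
  have e: "sqrt_iter z (Suc (Suc n)) - s' = complex_of_real (1/2) *\<^sub>C (s' * (s' - s) + (s' - s) * s)"
  proof -
    have "sqrt_iter z (Suc (Suc n)) = complex_of_real (1/2) *\<^sub>C (z + s' * s')" "s' = complex_of_real (1/2) *\<^sub>C (z + s * s)"
      by (simp_all only: s'_def s_def sqrt_iter.simps)
    then have "sqrt_iter z (Suc (Suc n)) - s' = complex_of_real (1/2) *\<^sub>C ((z + s' * s') - (z + s * s))"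
      by (metis scaleC_diff_right)
    also have "(z + s' * s') - (z + s * s) = s' * (s' - s) + (s' - s) * s" by (simp add: algebra_simps)
    finally show ?thesis .
  qed
  have "norm (op_apply s' (op_apply (s' - s) x)) \<le> t' * ((t' - t) * norm x)"
    using st(2)[of "op_apply (s' - s) x"] mult_left_mono[OF IH tt(2), of x] by linarith
  moreover have "norm (op_apply (s' - s) (op_apply s x)) \<le> (t' - t) * (t * norm x)"
    \<comment> \<open>By the induction hypothesis \<open>t' < t\<close> is possible only on the zero vector.\<close>
  proof (cases "t' - t \<ge> 0")
    case True
    then show ?thesis using IH[of "op_apply s x"] mult_left_mono[OF st(1) True, of x] by linarith
  next
    case False
    then have "norm x = 0" using td[of x] by (metis norm_ge_zero mult_less_0_iff not_le order_le_less)
    then show ?thesis by (simp add: op_zero)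
  qed
  ultimately have "norm (op_apply s' (op_apply (s' - s) x) + op_apply (s' - s) (op_apply s x)) \<le> t' * ((t' - t) * norm x) + (t' - t) * (t * norm x)"
    by (intro order_trans[OF norm_triangle_ineq] add_mono)
  also have "\<dots> = (t'\<^sup>2 - t\<^sup>2) * norm x" by (simp add: power2_eq_square algebra_simps)
  finally have "norm (op_apply (sqrt_iter z (Suc (Suc n)) - s') x) \<le> 1/2 * ((t'\<^sup>2 - t\<^sup>2) * norm x)"
    unfolding e op_apply_of_real by (simp add: op_apply_simps(1,4))
  also have "1/2 * ((t'\<^sup>2 - t\<^sup>2) * norm x) = (sqrt_bound (Suc (Suc n)) - t') * norm x"
  proof -
    have "sqrt_bound (Suc (Suc n)) = (1 + t'\<^sup>2) / 2" "t' = (1 + t\<^sup>2) / 2" by (simp_all only: t_def t'_def sqrt_bound.simps)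
    moreover have "p - q = 1/2 * (c - d)" if "p = (1 + c) / 2" "q = (1 + d) / 2" for p q c d :: real
      using that by simp
    ultimately have "sqrt_bound (Suc (Suc n)) - t' = 1/2 * (t'\<^sup>2 - t\<^sup>2)" by blast
    then show ?thesis by (simp only: mult.assoc)
  qed
  finally show ?case by (simp only: s'_def t'_def)
qed

lemma sqrt_of_one_minus:
  fixes z :: "'h::complex_hilbert bounded_op"
  assumes adj: "is_adjoint z z" and le: "\<And>x. norm (op_apply z x) \<le> norm x"
  obtains w where "is_adjoint w w" "\<And>x. norm (op_apply w x) \<le> norm x" "z + w * w = w + w"
    "\<And>b. b * z = z * b \<Longrightarrow> b * w = w * b"
proof -
  have tel: "(\<Sum>n<N. sqrt_bound (Suc n) - sqrt_bound n) = sqrt_bound N" for N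
    using sum_lessThan_telescope[of sqrt_bound N] by simp
  have mono: "sqrt_bound (Suc n) - sqrt_bound n \<ge> 0" for n
  proof -
    have "0 \<le> (1 - sqrt_bound n)\<^sup>2" by simp
    then show ?thesis by (simp add: power2_diff)
  qed
  have "summable (\<lambda>n. sqrt_bound (Suc n) - sqrt_bound n)"
    by (rule summableI_nonneg_bounded[where x = 1]) (use mono tel sqrt_bound_range in auto)
  then obtain w where w: "\<And>x. (\<lambda>n. op_apply (sqrt_iter z (Suc n) - sqrt_iter z n) x) sums op_apply w x"
    using operator_series[of "\<lambda>n. sqrt_iter z (Suc n) - sqrt_iter z n", OF sqrt_iter_step[OF le]] by blast
  have lim: "(\<lambda>n. op_apply (sqrt_iter z n) x) \<longlonglongrightarrow> op_apply w x" for x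
  proof -
    have "(\<Sum>n<N. op_apply (sqrt_iter z (Suc n) - sqrt_iter z n) x) = op_apply (sqrt_iter z N) x" for N
      using sum_lessThan_telescope[of "\<lambda>n. op_apply (sqrt_iter z n) x" N] by (simp add: op_apply_simps(2,5) del: sqrt_iter.simps(2))
    then show ?thesis using w[of x] unfolding sums_def by simp
  qed
  have n1: "norm (op_apply (sqrt_iter z n) x) \<le> norm x" for n x
    using sqrt_iter_norm[OF le, of n x] mult_right_mono[of "sqrt_bound n" 1 "norm x"] sqrt_bound_range[of n] by force
  show ?thesis
  proof (rule that)
    have "is_adjoint (sqrt_iter z n) (sqrt_iter z n)" for n
      by (induction n) (simp_all add: is_adjoint_zero is_adjoint_of_real is_adjoint_add is_adjoint_mult adj del: of_real_divide)
    then show "is_adjoint w w" by (rule limit_selfadjoint[OF lim])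
    show "norm (op_apply w x) \<le> norm x" for x
      by (rule LIMSEQ_le_const2[OF tendsto_norm[OF lim]]) (use n1 in blast)
    show "b * w = w * b" if b: "b * z = z * b" for b
    proof (rule limit_commutes[OF lim])
      fix n show "b * sqrt_iter z n = sqrt_iter z n * b"
      proof (induction n)
        case (Suc n)
        then have "b * (sqrt_iter z n * sqrt_iter z n) = sqrt_iter z n * sqrt_iter z n * b"
          by (metis mult.assoc)
        then show ?case using b by (simp add: scaleC_mult distrib_left distrib_right)
      qed simp
    qed
    show "z + w * w = w + w"
    proof (rule bounded_op_eqI)
      fix x
      let ?s = "\<lambda>n. op_apply (sqrt_iter z n)"
      have "(\<lambda>n. ?s n (?s n x) - op_apply w (op_apply w x)) \<longlonglongrightarrow> 0"
      proof (rule tendsto_norm_zero_cancel, rule tendsto_sandwich[OF always_eventually always_eventually tendsto_const])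
        let ?B = "\<lambda>n. norm (?s n x - op_apply w x) + norm (?s n (op_apply w x) - op_apply w (op_apply w x))"
        have "?B \<longlonglongrightarrow> norm (op_apply w x - op_apply w x) + norm (op_apply w (op_apply w x) - op_apply w (op_apply w x))"
          by (intro tendsto_intros lim)
        then show "?B \<longlonglongrightarrow> 0" by simp
        show "\<forall>n. norm (?s n (?s n x) - op_apply w (op_apply w x)) \<le> ?B n"
        proof
          fix n
          have "?s n (?s n x) - op_apply w (op_apply w x) = ?s n (?s n x - op_apply w x) + (?s n (op_apply w x) - op_apply w (op_apply w x))"
            by (simp add: op_diff)
          also have "norm \<dots> \<le> norm (?s n (?s n x - op_apply w x)) + norm (?s n (op_apply w x) - op_apply w (op_apply w x))"
            by (rule norm_triangle_ineq)
          also have "\<dots> \<le> ?B n" by (intro add_mono n1) simp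
          finally show "norm (?s n (?s n x) - op_apply w (op_apply w x)) \<le> ?B n" .
        qed
      qed simp
      then have "(\<lambda>n. (1/2) *\<^sub>R (op_apply z x + (?s n (?s n x)))) \<longlonglongrightarrow> (1/2) *\<^sub>R (op_apply z x + op_apply w (op_apply w x))"
        by (intro tendsto_intros) (simp add: LIM_zero_iff)
      then have "(\<lambda>n. ?s (Suc n) x) \<longlonglongrightarrow> (1/2) *\<^sub>R (op_apply z x + op_apply w (op_apply w x))"
        by (simp add: op_apply_of_real op_apply_simps(1,4) del: of_real_divide)
      then have "(1/2) *\<^sub>R (op_apply z x + op_apply w (op_apply w x)) = op_apply w x"
        using LIMSEQ_unique LIMSEQ_Suc[OF lim] by blast
      then have "(2::real) *\<^sub>R ((1/2) *\<^sub>R (op_apply z x + op_apply w (op_apply w x))) = op_apply w x + op_apply w x"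
        by (simp only: scaleR_2)
      then show "op_apply (z + w * w) x = op_apply (w + w) x"
        by (simp add: op_apply_simps)
    qed
  qed
qed

text \<open>For a self-adjoint contraction \<open>y\<close> the operator \<open>1 - y\<^sup>2\<close> is again a contraction, so \<open>y\<^sup>2\<close>
  has a square root \<open>1 - w\<close>, which is positive because \<open>w\<close> is a contraction.\<close>
lemma absolute_value:
  fixes x :: "'h::complex_hilbert bounded_op"
  assumes adj: "is_adjoint x x" and le: "\<And>\<xi>. norm (op_apply x \<xi>) \<le> R * norm \<xi>" and R: "R > 0"
  obtains a where "is_adjoint a a" "a * a = x * x" "\<And>\<xi>. 0 \<le> Re (cinner (op_apply a \<xi>) \<xi>)"
    "\<And>b. b * x = x * b \<Longrightarrow> b * a = a * b"
proof -
  define y where "y = complex_of_real (1 / R) *\<^sub>C x"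
  have y: "is_adjoint y y" unfolding y_def by (rule is_adjoint_of_real[OF adj])
  have yn: "norm (op_apply y \<xi>) \<le> norm \<xi>" for \<xi>
    using le[of \<xi>] R unfolding y_def op_apply_of_real by (simp add: field_simps)
  have zn: "norm (op_apply (1 - y * y) \<xi>) \<le> norm \<xi>" for \<xi>
  proof -
    let ?u = "op_apply y (op_apply y \<xi>)"
    have "cinner \<xi> ?u = cinner (op_apply y \<xi>) (op_apply y \<xi>)" using is_adjointD[OF y] by simp
    then have "Re (cinner \<xi> ?u) = (norm (op_apply y \<xi>))\<^sup>2" by (simp add: norm_sq_cinner)
    then have "(norm (\<xi> + - ?u))\<^sup>2 = (norm \<xi>)\<^sup>2 + (norm ?u)\<^sup>2 - 2 * (norm (op_apply y \<xi>))\<^sup>2"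
      using norm_add_sq[of \<xi> "- ?u"] by (simp add: bounded_bilinear.minus_right[OF bounded_bilinear_cinner])
    moreover have "(norm ?u)\<^sup>2 \<le> (norm (op_apply y \<xi>))\<^sup>2" using yn by (simp add: power_mono)
    moreover have "0 \<le> (norm ?u)\<^sup>2" by simp
    ultimately have "(norm (\<xi> + - ?u))\<^sup>2 \<le> (norm \<xi>)\<^sup>2" by linarith
    then show ?thesis using power2_le_imp_le[of "norm (\<xi> + - ?u)" "norm \<xi>"] by (simp add: op_apply_simps)
  qed
  obtain w where w: "is_adjoint w w" "\<And>x. norm (op_apply w x) \<le> norm x" "1 - y * y + w * w = w + w"
    and comm: "\<And>b. b * (1 - y * y) = (1 - y * y) * b \<Longrightarrow> b * w = w * b"
    using sqrt_of_one_minus[OF is_adjoint_diff[OF is_adjoint_one is_adjoint_mult[OF y y]] zn] by blast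
  have yy: "(1 - w) * (1 - w) = y * y" using w(3) by (simp add: algebra_simps)
  show ?thesis
  proof (rule that[of "complex_of_real R *\<^sub>C (1 - w)"])
    show "is_adjoint (complex_of_real R *\<^sub>C (1 - w)) (complex_of_real R *\<^sub>C (1 - w))"
      by (intro is_adjoint_of_real is_adjoint_diff is_adjoint_one w)
    show "(complex_of_real R *\<^sub>C (1 - w)) * (complex_of_real R *\<^sub>C (1 - w)) = x * x"
      unfolding scaleC_mult yy y_def scaleC_scaleC using R by (simp add: scaleC_one)
    show "0 \<le> Re (cinner (op_apply (complex_of_real R *\<^sub>C (1 - w)) \<xi>) \<xi>)" for \<xi>
    proof -
      have "Re (cinner (op_apply w \<xi>) \<xi>) \<le> norm (op_apply w \<xi>) * norm \<xi>" by (rule Re_cinner_le)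
      also have "\<dots> \<le> norm \<xi> * norm \<xi>" by (intro mult_right_mono w) simp
      finally have "Re (cinner (op_apply w \<xi>) \<xi>) \<le> Re (cinner \<xi> \<xi>)"
        by (simp add: power2_eq_square flip: norm_sq_cinner)
      then show ?thesis
        using R by (simp add: op_apply_simps cinner_scaleC_left cinner_diff_left)
    qed
    show "b * (complex_of_real R *\<^sub>C (1 - w)) = (complex_of_real R *\<^sub>C (1 - w)) * b" if "b * x = x * b" for b
    proof -
      have "b * y = y * b" using that by (simp add: y_def scaleC_mult)
      then have "b * (y * y) = (y * y) * b" by (metis mult.assoc)
      then have "b * w = w * b" by (intro comm) (simp add: algebra_simps)
      then show ?thesis by (simp add: scaleC_mult left_diff_distrib right_diff_distrib)
    qed
  qed
qed

text \<open>An operator between \<open>0\<close> and \<open>R\<close> is within \<open>R / 2\<close> of the scalar \<open>R / 2\<close>. Expanding the square, this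
  amounts to \<open>a\<^sup>2 \<le> R a\<close>, which follows from positivity of \<open>a\<close> at the vector \<open>(R - a) \<xi>\<close>.\<close>
lemma positive_centre_bound:
  assumes adj: "is_adjoint a a" and pos: "\<And>\<xi>. 0 \<le> Re (cinner (op_apply a \<xi>) \<xi>)"
    and le: "\<And>\<xi>. norm (op_apply a \<xi>) \<le> R * norm \<xi>" and R: "R > 0"
  shows "norm (op_apply a \<xi> - (R / 2) *\<^sub>R \<xi>) \<le> R / 2 * norm \<xi>"
proof -
  define u where "u = op_apply a \<xi>"
  define p where "p = Re (cinner u \<xi>)"
  define N where "N = (norm u)\<^sup>2"
  have 1: "Re (cinner (op_apply a u) u) \<le> R * N"
  proof -
    have "Re (cinner (op_apply a u) u) \<le> norm (op_apply a u) * norm u" by (rule Re_cinner_le)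
    also have "\<dots> \<le> R * norm u * norm u" by (intro mult_right_mono le) simp
    finally show ?thesis by (simp add: N_def power2_eq_square)
  qed
  have 2: "cinner (op_apply a u) \<xi> = cinner u u" using is_adjointD[OF adj] by (simp add: u_def)
  have "0 \<le> Re (cinner (op_apply a (R *\<^sub>R \<xi> - u)) (R *\<^sub>R \<xi> - u))" by (rule pos)
  also have "\<dots> = R * (R * p) - R * N - R * N + Re (cinner (op_apply a u) u)"
    by (simp add: op_diff op_scaleR cinner_diff_left cinner_diff_right 2 p_def N_def norm_sq_cinner
        bounded_bilinear.scaleR_left[OF bounded_bilinear_cinner] bounded_bilinear.scaleR_right[OF bounded_bilinear_cinner] algebra_simps flip: u_def)
  finally have "R * N \<le> R * (R * p)" using 1 by linarith
  then have 3: "N \<le> R * p" using R by simp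
  have "(norm (u + - ((R / 2) *\<^sub>R \<xi>)))\<^sup>2 = N + (R / 2)\<^sup>2 * (norm \<xi>)\<^sup>2 - R * p"
    unfolding norm_add_sq N_def p_def
    by (simp add: bounded_bilinear.scaleR_right[OF bounded_bilinear_cinner] bounded_bilinear.minus_right[OF bounded_bilinear_cinner] power_mult_distrib power_divide)
  then have "(norm (u - (R / 2) *\<^sub>R \<xi>))\<^sup>2 \<le> (R / 2 * norm \<xi>)\<^sup>2" using 3 by (simp add: power_mult_distrib power_divide)
  then show ?thesis using power2_le_imp_le[of _ "R / 2 * norm \<xi>"] R by (simp add: u_def)
qed

section \<open>Projections in a von Neumann algebra\<close>

locale vn_algebra =
  fixes M :: "'h::complex_hilbert bounded_op set"
  assumes vn: "von_neumann_algebra M"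
begin

lemma one_mem: "1 \<in> M"
  and add_mem: "a \<in> M \<Longrightarrow> b \<in> M \<Longrightarrow> a + b \<in> M"
  and scaleC_mem: "a \<in> M \<Longrightarrow> c *\<^sub>C a \<in> M"
  and mult_mem: "a \<in> M \<Longrightarrow> b \<in> M \<Longrightarrow> a * b \<in> M"
  and adjoint_mem: "a \<in> M \<Longrightarrow> \<exists>b\<in>M. is_adjoint a b"
  using vn unfolding von_neumann_algebra_def unital_star_subalgebra_def by blast+

lemma diff_mem: assumes "a \<in> M" "b \<in> M" shows "a - b \<in> M"
proof -
  have "(-1) *\<^sub>C b = - b" by (simp add: scaleC_minus_left scaleC_one)
  then show ?thesis using add_mem[OF assms(1) scaleC_mem[OF assms(2), of "-1"]] by simp
qed

lemma zero_mem: "0 \<in> M" using diff_mem[OF one_mem one_mem] by simp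

lemma mem_if_commutes:
  assumes "\<And>b. (\<And>a. a \<in> M \<Longrightarrow> b * a = a * b) \<Longrightarrow> b * x = x * b" shows "x \<in> M"
proof -
  have "x \<in> commutant (commutant M)" using assms by (auto simp: commutant_def)
  then show ?thesis using vn by (simp add: von_neumann_algebra_def)
qed

text \<open>The projection onto the closed span of the ranges of a set \<open>A\<close> of elements lies in \<open>M\<close>:
  an operator commuting with \<open>M\<close> preserves this span, and it preserves the orthogonal complement,
  which is the common kernel of the adjoints of the elements of \<open>A\<close>. The annihilator conditions
  let later arguments avoid vectors.\<close>
lemma range_projection:
  assumes A: "A \<subseteq> M"
  obtains P where "projection_in M P" "\<forall>a\<in>A. P * a = a"
    "\<forall>c. (\<forall>a\<in>A. c * a = 0) \<longrightarrow> c * P = 0"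
    "\<forall>\<xi>. (\<forall>a\<in>A. \<forall>\<zeta>. cinner \<xi> (op_apply a \<zeta>) = 0) \<longrightarrow> op_apply P \<xi> = 0"
proof -
  define G where "G = (\<Union>a\<in>A. range (op_apply a))"
  have "c *\<^sub>C g \<in> G" if "g \<in> G" for c g
  proof -
    from that obtain a \<zeta> where "a \<in> A" "g = op_apply a \<zeta>" by (auto simp: G_def)
    then have "c *\<^sub>C g = op_apply a (c *\<^sub>C \<zeta>)" by (simp add: op_scaleC)
    then show ?thesis using \<open>a \<in> A\<close> by (auto simp: G_def)
  qed
  then obtain P where P: "is_adjoint P P" "\<And>x. op_apply P x \<in> closure (span G)"
    "\<And>v. v \<in> closure (span G) \<Longrightarrow> op_apply P v = v"
    using projection_onto_closed_span by metis
  have GP: "op_apply P g = g" if "g \<in> G" for g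
    using that by (intro P(3)) (meson closure_subset span_base subsetD)
  have perp: "op_apply P \<xi> = 0" if "\<And>g. g \<in> G \<Longrightarrow> cinner \<xi> g = 0" for \<xi>
  proof -
    have "closure (span G) \<subseteq> {v. cinner (op_apply P \<xi>) v = 0}" (is "_ \<subseteq> ?K")
    proof (intro closure_minimal span_minimal)
      show "G \<subseteq> ?K" using that is_adjointD[OF P(1)] GP by auto
      show "subspace ?K"
        by (auto simp: subspace_def cinner_zero_right cinner_add_right bounded_bilinear.scaleR_right[OF bounded_bilinear_cinner])
      show "closed ?K"
        by (intro closed_Collect_eq continuous_intros linear_continuous_on bounded_bilinear.bounded_linear_right bounded_bilinear_cinner)
    qed
    then show ?thesis using P(2)[of \<xi>] by (auto simp: cinner_self)
  qed
  have im: "op_apply c v \<in> closure (span G)" if "\<And>g. g \<in> G \<Longrightarrow> op_apply c g \<in> G" "v \<in> closure (span G)" for c v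
  proof -
    have "op_apply c ` closure (span G) \<subseteq> closure (op_apply c ` span G)"
      by (rule closure_bounded_linear_image_subset[OF bounded_linear_op])
    also have "op_apply c ` span G = span (op_apply c ` G)"
      by (rule linear_span_image[symmetric]) (rule bounded_linear.linear[OF bounded_linear_op])
    also have "closure \<dots> \<subseteq> closure (span G)" using that(1) by (intro closure_mono span_mono) auto
    finally show ?thesis using that(2) by auto
  qed
  have PP: "P * P = P" by (rule bounded_op_eqI) (simp add: op_apply_simps P(2,3))
  have "P \<in> M"
  proof (rule mem_if_commutes)
    fix b assume b: "\<And>a. a \<in> M \<Longrightarrow> b * a = a * b"
    have "op_apply b g \<in> G" if "g \<in> G" for g
    proof -
      from that obtain a \<zeta> where a: "a \<in> A" "g = op_apply a \<zeta>" by (auto simp: G_def)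
      then have "op_apply b g = op_apply a (op_apply b \<zeta>)" using b A by (metis op_apply_simps(4) subsetD)
      then show ?thesis using a by (auto simp: G_def)
    qed
    then have 1: "op_apply P (op_apply b (op_apply P x)) = op_apply b (op_apply P x)" for x
      using im P(2,3) by blast
    have 2: "op_apply P (op_apply b (x - op_apply P x)) = 0" for x
    proof (rule perp)
      fix g assume "g \<in> G"
      then obtain a \<zeta> where a: "a \<in> A" "g = op_apply a \<zeta>" by (auto simp: G_def)
      obtain a' where a': "a' \<in> M" "is_adjoint a a'" using a A adjoint_mem by blast
      have z: "op_apply a' (x - op_apply P x) = 0"
      proof (rule cinner_eq_all)
        fix \<eta>
        have "op_apply P (op_apply a \<eta>) = op_apply a \<eta>" using a by (intro GP) (auto simp: G_def)
        then have "cinner (op_apply P x) (op_apply a \<eta>) = cinner x (op_apply a \<eta>)"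
          using is_adjointD[OF P(1)] by simp
        then show "cinner (op_apply a' (x - op_apply P x)) \<eta> = cinner 0 \<eta>"
          using is_adjointD[OF is_adjoint_sym[OF a'(2)]] by (simp add: cinner_diff_left cinner_zero_left)
      qed
      have "cinner (op_apply b (x - op_apply P x)) g = cinner (op_apply a' (op_apply b (x - op_apply P x))) \<zeta>"
        using is_adjointD[OF is_adjoint_sym[OF a'(2)]] a by simp
      also have "op_apply a' (op_apply b (x - op_apply P x)) = op_apply b (op_apply a' (x - op_apply P x))"
        using b[OF a'(1)] by (metis op_apply_simps(4))
      finally show "cinner (op_apply b (x - op_apply P x)) g = 0" by (simp add: z op_zero cinner_zero_left)
    qed
    show "b * P = P * b"
      by (rule bounded_op_eqI) (use 1 2 in \<open>simp add: op_apply_simps op_diff\<close>)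
  qed
  show ?thesis
  proof (rule that)
    show "projection_in M P" using \<open>P \<in> M\<close> PP P(1) by (simp add: projection_in_def)
    show "\<forall>a\<in>A. P * a = a"
    proof (intro ballI bounded_op_eqI)
      fix a x assume "a \<in> A"
      then have "op_apply a x \<in> G" by (auto simp: G_def)
      then show "op_apply (P * a) x = op_apply a x" by (simp add: op_apply_simps GP)
    qed
    show "\<forall>c. (\<forall>a\<in>A. c * a = 0) \<longrightarrow> c * P = 0"
    proof (intro allI impI bounded_op_eqI)
      fix c x assume c: "\<forall>a\<in>A. c * a = 0"
      have "closure (span G) \<subseteq> {v. op_apply c v = 0}" (is "_ \<subseteq> ?K")
      proof (intro closure_minimal span_minimal)
        show "G \<subseteq> ?K"
        proof
          fix g assume "g \<in> G"
          then obtain a \<zeta> where "a \<in> A" "g = op_apply a \<zeta>" by (auto simp: G_def)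
          then show "g \<in> ?K" using c op_apply_simps(4)[of c a \<zeta>] by (simp add: op_apply_simps(5))
        qed
        show "subspace ?K" by (auto simp: subspace_def op_zero op_add op_scaleR)
        show "closed ?K" by (intro closed_Collect_eq continuous_intros linear_continuous_on bounded_linear_op)
      qed
      then show "op_apply (c * P) x = op_apply 0 x" using P(2)[of x] by (auto simp: op_apply_simps)
    qed
    show "\<forall>\<xi>. (\<forall>a\<in>A. \<forall>\<zeta>. cinner \<xi> (op_apply a \<zeta>) = 0) \<longrightarrow> op_apply P \<xi> = 0"
      by (auto simp: G_def intro!: perp)
  qed
qed

text \<open>A substitute for spectral projections. The range projection \<open>P\<close> of \<open>\<bar>x\<bar> + x\<close> satisfies \<open>x P = \<bar>x\<bar> P\<close> and
  \<open>x (1 - P) = - \<bar>x\<bar> (1 - P)\<close>. Thus the spectrum of \<open>x\<close>, contained in \<open>[- R, R]\<close>, is cut at \<open>0\<close> into two parts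
  of half the length, centred at \<open>R / 2\<close> and at \<open>- R / 2\<close>.\<close>
lemma bisection:
  assumes x: "x \<in> M" "is_adjoint x x" and le: "\<And>\<xi>. norm (op_apply x \<xi>) \<le> R * norm \<xi>" and R: "R > 0"
  obtains P where "projection_in M P" "\<And>b. b \<in> M \<Longrightarrow> is_adjoint b b \<Longrightarrow> b * x = x * b \<Longrightarrow> b * P = P * b"
    "\<And>\<xi>. norm (op_apply ((x - complex_of_real (R/2) *\<^sub>C 1) * P) \<xi>) \<le> R / 2 * norm \<xi>"
    "\<And>\<xi>. norm (op_apply ((x + complex_of_real (R/2) *\<^sub>C 1) * (1 - P)) \<xi>) \<le> R / 2 * norm \<xi>"
proof -
  obtain a where a: "is_adjoint a a" "a * a = x * x" "\<And>\<xi>. 0 \<le> Re (cinner (op_apply a \<xi>) \<xi>)"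
    and comm: "\<And>b. b * x = x * b \<Longrightarrow> b * a = a * b"
    using absolute_value[OF x(2) le R] by blast
  have aM: "a \<in> M" using comm x(1) by (intro mem_if_commutes) blast
  have "norm (op_apply a \<xi>) \<le> R * norm \<xi>" for \<xi>
  proof -
    have "(norm (op_apply a \<xi>))\<^sup>2 = Re (cinner \<xi> (op_apply (a * a) \<xi>))"
      using is_adjointD[OF a(1)] by (simp add: norm_sq_cinner op_apply_simps)
    also have "\<dots> = (norm (op_apply x \<xi>))\<^sup>2"
      unfolding a(2) using is_adjointD[OF x(2)] by (simp add: norm_sq_cinner op_apply_simps)
    finally show ?thesis using le[of \<xi>] by simp
  qed
  then have cb: "norm (op_apply a \<xi> - (R / 2) *\<^sub>R \<xi>) \<le> R / 2 * norm \<xi>" for \<xi>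
    by (rule positive_centre_bound[OF a(1,3) _ R])
  have "{a + x} \<subseteq> M" using add_mem[OF aM x(1)] by simp
  then obtain P where P: "projection_in M P" and P': "\<forall>b\<in>{a + x}. P * b = b"
    "\<forall>c. (\<forall>b\<in>{a + x}. c * b = 0) \<longrightarrow> c * P = 0"
    by (rule range_projection)
  have Pax: "P * (a + x) = a + x" and Pc: "c * (a + x) = 0 \<Longrightarrow> c * P = 0" for c
    using P' by simp_all
  have PP: "P * P = P" "is_adjoint P P" using P by (simp_all add: projection_in_def)
  have QQ: "(1 - P) * (1 - P) = 1 - P" "is_adjoint (1 - P) (1 - P)"
    using PP by (simp_all add: algebra_simps is_adjoint_diff is_adjoint_one)
  have bP: "b * P = P * b" if b: "b \<in> M" "is_adjoint b b" "b * x = x * b" for b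
    by (rule commutes_with_range[OF PP(2) Pax Pc b(2)]) (use b(3) comm[OF b(3)] in \<open>simp_all add: algebra_simps\<close>)
  have xa: "x * a = a * x" using comm by blast
  have "(a - x) * (a + x) = 0" using xa a(2) by (simp add: algebra_simps)
  then have "(a - x) * P = 0" by (rule Pc)
  then have 1: "x * P = a * P" by (simp add: algebra_simps)
  have aP: "a * P = P * a" using bP[OF aM a(1)] xa by simp
  have xP: "x * P = P * x" using bP[OF x] by simp
  have "(a + x) * P = a + x" using Pax aP xP by (simp add: distrib_left distrib_right)
  then have 2: "x * (1 - P) = - (a * (1 - P))" by (simp add: algebra_simps eq_neg_iff_add_eq_0)
  show ?thesis
  proof (rule that[OF P bP])
    fix \<xi>
    have "op_apply ((x - complex_of_real (R/2) *\<^sub>C 1) * P) \<xi> = op_apply a (op_apply P \<xi>) - (R / 2) *\<^sub>R op_apply P \<xi>"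
      using arg_cong[OF 1, of "\<lambda>t. op_apply t \<xi>"] by (simp add: op_apply_simps(1-6) op_apply_of_real left_diff_distrib scaleC_mult del: of_real_divide)
    then show "norm (op_apply ((x - complex_of_real (R/2) *\<^sub>C 1) * P) \<xi>) \<le> R / 2 * norm \<xi>"
      using order_trans[OF cb[of "op_apply P \<xi>"] mult_left_mono[OF norm_projection_le[OF PP]]] R by simp
    have "op_apply ((x + complex_of_real (R/2) *\<^sub>C 1) * (1 - P)) \<xi> = op_apply (x * (1 - P)) \<xi> + (R / 2) *\<^sub>R op_apply (1 - P) \<xi>"
      by (simp add: op_apply_simps(1,4,6) op_apply_of_real distrib_right scaleC_mult del: of_real_divide)
    also have "\<dots> = - (op_apply a (op_apply (1 - P) \<xi>) - (R / 2) *\<^sub>R op_apply (1 - P) \<xi>)"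
      unfolding 2 by (simp add: op_apply_simps(3,4))
    finally show "norm (op_apply ((x + complex_of_real (R/2) *\<^sub>C 1) * (1 - P)) \<xi>) \<le> R / 2 * norm \<xi>"
      using order_trans[OF cb[of "op_apply (1 - P) \<xi>"] mult_left_mono[OF norm_projection_le[OF QQ]]] R
      by (simp add: norm_minus_commute)
  qed
qed

end

section \<open>Maps compatible with left multiplication by projections\<close>
lemma bounded_by_scaled_decrements:
  fixes f g :: "nat \<Rightarrow> real"
  assumes fg: "\<And>n. f n - f (Suc n) \<le> c ^ n * (g n - g (Suc n))" and g: "\<And>n. g (Suc n) \<le> g n" "\<And>n. 0 \<le> g n"
    and c: "0 \<le> c" "c \<le> 1" and f: "f \<longlonglongrightarrow> 0"
  shows "f n \<le> c ^ n * g 0"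
proof -
  have g0: "g n \<le> g 0" for n using g(1) by (induction n) (auto intro: order_trans)
  have "f n - f (n + j) \<le> c ^ n * (g n - g (n + j))" for j
  proof (induction j)
    case (Suc j)
    have "c ^ (n + j) \<le> c ^ n" using c by (simp add: power_decreasing)
    then have "c ^ (n + j) * (g (n + j) - g (Suc (n + j))) \<le> c ^ n * (g (n + j) - g (Suc (n + j)))"
      using g(1)[of "n + j"] by (intro mult_right_mono) auto
    then have "f (n + j) - f (Suc (n + j)) \<le> c ^ n * (g (n + j) - g (Suc (n + j)))"
      using fg[of "n + j"] by linarith
    then show ?case using Suc by (simp add: right_diff_distrib)
  qed simp
  moreover have "c ^ n * (g n - g (n + j)) \<le> c ^ n * g 0" for j
    using g0[of n] g(2)[of "n + j"] c by (intro mult_left_mono) auto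
  ultimately have "f n - f (n + j) \<le> c ^ n * g 0" for j using order_trans by blast
  moreover have "(\<lambda>j. f n - f (n + j)) \<longlonglongrightarrow> f n - 0"
    using LIMSEQ_ignore_initial_segment[OF f, of n] by (intro tendsto_intros) (simp add: add.commute)
  ultimately show ?thesis using LIMSEQ_le_const2[of "\<lambda>j. f n - f (n + j)" "f n - 0"] by auto
qed

lemma commuting_projections_mult:
  assumes "P * P = P" "is_adjoint P P" "Q * Q = Q" "is_adjoint Q Q" "P * Q = Q * P"
  shows "(P * Q) * (P * Q) = P * Q" "is_adjoint (P * Q) (P * Q)"
proof -
  show "(P * Q) * (P * Q) = P * Q" using assms(1,3,5) by (metis mult.assoc)
  show "is_adjoint (P * Q) (P * Q)" using is_adjoint_mult[OF assms(2,4)] assms(5) by simp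
qed

context vn_algebra
begin

lemma projection_in_D:
  assumes "projection_in M P" shows "P \<in> M" "P * P = P" "is_adjoint P P"
  using assms by (simp_all add: projection_in_def)

lemma projection_in_complement: "projection_in M P \<Longrightarrow> projection_in M (1 - P)"
  by (simp add: projection_in_def diff_mem one_mem algebra_simps is_adjoint_diff is_adjoint_one)

lemma kernel_projection:
  assumes x: "x \<in> M" "is_adjoint x x"
  obtains k where "projection_in M k" "k * x = 0" "\<And>\<xi>. op_apply x \<xi> = 0 \<Longrightarrow> op_apply k \<xi> = \<xi>"
proof -
  have "{x} \<subseteq> M" using x by simp
  then obtain P where P: "projection_in M P" and P': "\<forall>b\<in>{x}. P * b = b"
    "\<forall>\<xi>. (\<forall>b\<in>{x}. \<forall>\<zeta>. cinner \<xi> (op_apply b \<zeta>) = 0) \<longrightarrow> op_apply P \<xi> = 0"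
    by (rule range_projection)
  show ?thesis
  proof (rule that[of "1 - P"])
    show "projection_in M (1 - P)" by (rule projection_in_complement[OF P])
    show "(1 - P) * x = 0" using P' by (simp add: algebra_simps)
    show "op_apply (1 - P) \<xi> = \<xi>" if "op_apply x \<xi> = 0" for \<xi>
    proof -
      have "cinner \<xi> (op_apply x \<zeta>) = 0" for \<zeta>
        using is_adjointD[OF x(2), of \<xi> \<zeta>] that by (simp add: cinner_zero_left)
      then have "op_apply P \<xi> = 0" using P'(2) by blast
      then show ?thesis by (simp add: op_apply_simps)
    qed
  qed
qed

text \<open>One of the two halves carries at least half of the squared length of \<open>q \<zeta>\<close>; that half is kept.\<close>
lemma bisection_step:
  fixes \<zeta> :: 'h
  assumes y: "y \<in> M" "is_adjoint y y" and q: "projection_in M q"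
    and comm: "\<And>b. b \<in> M \<Longrightarrow> is_adjoint b b \<Longrightarrow> b * y = y * b \<Longrightarrow> b * q = q * b"
    and le: "\<And>\<xi>. norm (op_apply ((y - complex_of_real l *\<^sub>C 1) * q) \<xi>) \<le> r * norm \<xi>" and r: "r > 0"
  obtains q' l' where "projection_in M q'" 
    "\<And>b. b \<in> M \<Longrightarrow> is_adjoint b b \<Longrightarrow> b * y = y * b \<Longrightarrow> b * q' = q' * b"
    "\<And>\<xi>. norm (op_apply ((y - complex_of_real l' *\<^sub>C 1) * q') \<xi>) \<le> r / 2 * norm \<xi>"
    "q' * q = q'" "\<bar>l' - l\<bar> \<le> r / 2" "(norm (op_apply q \<zeta>))\<^sup>2 \<le> 2 * (norm (op_apply q' \<zeta>))\<^sup>2"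
proof -
  note witness = that and qD = projection_in_D[OF q]
  define Y where "Y = y - complex_of_real l *\<^sub>C 1"
  have bY: "b * Y = Y * b" if "b * y = y * b" for b
    using that by (simp add: Y_def left_diff_distrib right_diff_distrib scaleC_mult)
  have Y: "Y \<in> M" "is_adjoint Y Y" unfolding Y_def
    by (intro diff_mem y scaleC_mem one_mem) (intro is_adjoint_diff y is_adjoint_of_real is_adjoint_one)
  have qy: "q * y = y * q" using comm[OF y] by simp
  have qY: "q * Y = Y * q" by (rule bY[OF qy])
  define x where "x = Y * q"
  have x: "x \<in> M" "is_adjoint x x"
    unfolding x_def using is_adjoint_mult[OF Y(2) qD(3)] qY by (auto intro: mult_mem Y qD)
  have xq: "x * q = x" "q * x = x" unfolding x_def using qD(2) qY by (metis mult.assoc)+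
  obtain P where P: "projection_in M P" and Pb: "\<And>b. b \<in> M \<Longrightarrow> is_adjoint b b \<Longrightarrow> b * x = x * b \<Longrightarrow> b * P = P * b"
    and le1: "\<And>\<xi>. norm (op_apply ((x - complex_of_real (r/2) *\<^sub>C 1) * P) \<xi>) \<le> r / 2 * norm \<xi>"
    and le2: "\<And>\<xi>. norm (op_apply ((x + complex_of_real (r/2) *\<^sub>C 1) * (1 - P)) \<xi>) \<le> r / 2 * norm \<xi>"
    using bisection[OF x le[folded Y_def x_def] r] by metis
  have qP: "q * P = P * q" using Pb[OF qD(1,3)] xq by simp
  have bP: "b * P = P * b" if b: "b \<in> M" "is_adjoint b b" "b * y = y * b" for b
  proof (rule Pb[OF b(1,2)])
    show "b * x = x * b" unfolding x_def using bY[OF b(3)] comm[OF b] by (metis mult.assoc)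
  qed
  have half: ?thesis
    if E: "projection_in M E" "q * E = E * q" "\<And>b. b \<in> M \<Longrightarrow> is_adjoint b b \<Longrightarrow> b * y = y * b \<Longrightarrow> b * E = E * b"
      and s: "\<bar>s\<bar> = r / 2"
      and le: "\<And>\<xi>. norm (op_apply ((x - complex_of_real s *\<^sub>C 1) * E) \<xi>) \<le> r / 2 * norm \<xi>"
      and big: "(norm (op_apply q \<zeta>))\<^sup>2 \<le> 2 * (norm (op_apply (E * q) \<zeta>))\<^sup>2" for E s
  proof (rule witness[of "E * q" "l + s"])
    note ED = projection_in_D[OF E(1)]
    show "projection_in M (E * q)"
      using commuting_projections_mult[OF ED(2,3) qD(2,3)] E(2) mult_mem[OF ED(1) qD(1)] by (simp add: projection_in_def)
    show "b * (E * q) = (E * q) * b" if "b \<in> M" "is_adjoint b b" "b * y = y * b" for b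
      using E(3)[OF that] comm[OF that] by (metis mult.assoc)
    show "E * q * q = E * q" using qD(2) by (simp add: mult.assoc)
    show "\<bar>l + s - l\<bar> \<le> r / 2" using s by simp
    show "norm (op_apply ((y - complex_of_real (l + s) *\<^sub>C 1) * (E * q)) \<xi>) \<le> r / 2 * norm \<xi>" for \<xi>
    proof -
      have 1: "y - complex_of_real (l + s) *\<^sub>C 1 = Y - complex_of_real s *\<^sub>C 1"
        by (simp add: Y_def scaleC_add_left)
      have "x * (E * q) = Y * (E * q)" unfolding x_def using E(2) qD(2) by (metis mult.assoc)
      then have "(y - complex_of_real (l + s) *\<^sub>C 1) * (E * q) = ((x - complex_of_real s *\<^sub>C 1) * E) * q"
        unfolding 1 by (simp add: left_diff_distrib mult.assoc)
      then have "norm (op_apply ((y - complex_of_real (l + s) *\<^sub>C 1) * (E * q)) \<xi>) \<le> r / 2 * norm (op_apply q \<xi>)"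
        using le by (simp only: op_apply_simps(4))
      also have "\<dots> \<le> r / 2 * norm \<xi>" using r by (intro mult_left_mono norm_projection_le qD) simp
      finally show ?thesis .
    qed
  qed (rule big)
  have split: "(norm (op_apply q \<zeta>))\<^sup>2 = (norm (op_apply (P * q) \<zeta>))\<^sup>2 + (norm (op_apply ((1 - P) * q) \<zeta>))\<^sup>2"
    using norm_projection_split[OF projection_in_D(2,3)[OF P], of "op_apply q \<zeta>"] by (simp only: op_apply_simps(4))
  show ?thesis
  proof (cases "(norm (op_apply q \<zeta>))\<^sup>2 \<le> 2 * (norm (op_apply (P * q) \<zeta>))\<^sup>2")
    case True
    show ?thesis by (rule half[of P "r/2"]) (use P qP bP le1 r True in auto)
  next
    case False
    show ?thesis
    proof (rule half[of "1 - P" "- (r/2)"])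
      show "projection_in M (1 - P)" by (rule projection_in_complement[OF P])
      show "q * (1 - P) = (1 - P) * q" using qP by (simp add: algebra_simps)
      show "b * (1 - P) = (1 - P) * b" if "b \<in> M" "is_adjoint b b" "b * y = y * b" for b
        using bP[OF that] by (simp add: algebra_simps)
      have "x - complex_of_real (- (r/2)) *\<^sub>C 1 = x + complex_of_real (r/2) *\<^sub>C 1"
        by (simp add: scaleC_minus_left)
      then show "norm (op_apply ((x - complex_of_real (- (r/2)) *\<^sub>C 1) * (1 - P)) \<xi>) \<le> r / 2 * norm \<xi>" for \<xi>
        using le2 by (simp only:)
      show "(norm (op_apply q \<zeta>))\<^sup>2 \<le> 2 * (norm (op_apply ((1 - P) * q) \<zeta>))\<^sup>2" using split False by linarith
      show "\<bar>- (r / 2)\<bar> = r / 2" using r by simp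
    qed
  qed
qed

lemma bisection_sequence:
  fixes \<zeta> :: 'h
  assumes y: "y \<in> M" "is_adjoint y y" and le: "\<And>\<xi>. norm (op_apply y \<xi>) \<le> R * norm \<xi>" and R: "R > 0"
  obtains q l where "\<And>n. projection_in M (q n)"
    "\<And>n b. b \<in> M \<Longrightarrow> is_adjoint b b \<Longrightarrow> b * y = y * b \<Longrightarrow> b * q n = q n * b"
    "\<And>n \<xi>. norm (op_apply ((y - complex_of_real (l n) *\<^sub>C 1) * q n) \<xi>) \<le> R / 2 ^ n * norm \<xi>"
    "\<And>n. q (Suc n) * q n = q (Suc n)" "\<And>n. \<bar>l (Suc n) - l n\<bar> \<le> R / 2 ^ Suc n"
    "\<And>n. (norm \<zeta>)\<^sup>2 \<le> 2 ^ n * (norm (op_apply (q n) \<zeta>))\<^sup>2"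
proof -
  define Good where "Good n p \<longleftrightarrow> projection_in M (fst p) \<and>
      (\<forall>b\<in>M. is_adjoint b b \<longrightarrow> b * y = y * b \<longrightarrow> b * fst p = fst p * b) \<and>
      (\<forall>\<xi>. norm (op_apply ((y - complex_of_real (snd p) *\<^sub>C 1) * fst p) \<xi>) \<le> R / 2 ^ n * norm \<xi>) \<and>
      (norm \<zeta>)\<^sup>2 \<le> 2 ^ n * (norm (op_apply (fst p) \<zeta>))\<^sup>2" for n :: nat and p :: "'h bounded_op \<times> real"
  define Next where "Next n p p' \<longleftrightarrow> fst p' * fst p = fst p' \<and> \<bar>snd p' - snd p\<bar> \<le> R / 2 ^ Suc n"
    for n :: nat and p p' :: "'h bounded_op \<times> real"
  have z: "0 *\<^sub>C (1 :: 'h bounded_op) = 0"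
    using scaleC_add_left[of 0 0 "1 :: 'h bounded_op"] by simp
  have "\<exists>f. \<forall>n. Good n (f n) \<and> Next n (f n) (f (Suc n))"
  proof (rule dependent_nat_choice)
    have "projection_in M 1" by (simp add: projection_in_def one_mem is_adjoint_one)
    then show "\<exists>p. Good 0 p" using le by (intro exI[of _ "(1, 0)"]) (simp add: Good_def z op_apply_simps)
  next
    fix p n assume G: "Good n p"
    obtain q l where p: "p = (q, l)" by (cases p)
    have r: "R / 2 ^ n > 0" using R by simp
    obtain q' l' where *: "projection_in M q'" 
      "\<And>b. b \<in> M \<Longrightarrow> is_adjoint b b \<Longrightarrow> b * y = y * b \<Longrightarrow> b * q' = q' * b"
      "\<And>\<xi>. norm (op_apply ((y - complex_of_real l' *\<^sub>C 1) * q') \<xi>) \<le> (R / 2 ^ n) / 2 * norm \<xi>"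
      "q' * q = q'" "\<bar>l' - l\<bar> \<le> (R / 2 ^ n) / 2" "(norm (op_apply q \<zeta>))\<^sup>2 \<le> 2 * (norm (op_apply q' \<zeta>))\<^sup>2"
      using bisection_step[OF y, of q l "R / 2 ^ n" \<zeta>] G r unfolding Good_def p fst_conv snd_conv by metis
    have "(norm \<zeta>)\<^sup>2 \<le> 2 ^ n * (norm (op_apply q \<zeta>))\<^sup>2" using G by (simp add: Good_def p)
    also have "\<dots> \<le> 2 ^ n * (2 * (norm (op_apply q' \<zeta>))\<^sup>2)" by (intro mult_left_mono *) simp
    finally have "(norm \<zeta>)\<^sup>2 \<le> 2 ^ Suc n * (norm (op_apply q' \<zeta>))\<^sup>2" by (simp add: mult.assoc mult.left_commute)
    moreover have "R / 2 ^ n / 2 = R / 2 ^ Suc n" by simp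
    ultimately have "Good (Suc n) (q', l')" "Next n p (q', l')"
      unfolding Good_def Next_def p fst_conv snd_conv using * by metis+
    then show "\<exists>p'. Good (Suc n) p' \<and> Next n p p'" by blast
  qed
  then obtain f where f: "\<And>n. Good n (f n)" "\<And>n. Next n (f n) (f (Suc n))" by blast
  show ?thesis
    by (rule that[of "\<lambda>n. fst (f n)" "\<lambda>n. snd (f n)"]) (use f in \<open>unfold Good_def Next_def; blast\<close>)+
qed

text \<open>A gliding hump argument takes the place of continuity of \<open>L\<close>. Fix \<open>\<xi>\<close> and put
  \<open>\<zeta> = L y \<xi>\<close>. Bisection yields decreasing projections \<open>q n\<close> and scalars \<open>l n\<close> such that \<open>(y - l n) q n\<close> has
  norm at most \<open>R / 2\<^sup>n\<close> while \<open>q n \<zeta>\<close> has squared length at least \<open>\<parallel>\<zeta>\<parallel>\<^sup>2 / 2\<^sup>n\<close>. Let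
  \<open>w = \<Sum>n. (3/2)\<^sup>n (y - l n) q n\<close>; the series converges since \<open>3/2 < 2\<close>. On \<open>r = q n - q (n + 1)\<close> only the
  first \<open>n + 1\<close> terms survive, so \<open>r w\<close> is a combination of \<open>r y\<close> and \<open>r\<close> in which \<open>r y\<close> has a coefficient
  of at least \<open>(3/2)\<^sup>n\<close>. As \<open>L\<close> kills projections, the length of \<open>r L w \<xi>\<close> is at
  least \<open>(3/2)\<^sup>n\<close> times that of \<open>r L y \<xi> = r \<zeta>\<close>. As \<open>q n \<zeta>\<close> tends to \<open>0\<close>, summing over \<open>n\<close> bounds the
  squared length of \<open>q n \<zeta>\<close> by a multiple of \<open>(4/9)\<^sup>n\<close>. Since \<open>4/9 < 1/2\<close>,
  the two bounds force \<open>\<zeta> = 0\<close>.\<close>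
lemma projection_linear_selfadjoint:
  assumes lin: "complex_linear_on M L" and proj: "\<And>e x. projection_in M e \<Longrightarrow> x \<in> M \<Longrightarrow> L (e * x) = e * L x"
    and L1: "L 1 = 0" and y: "y \<in> M" "is_adjoint y y"
  shows "L y = 0"
proof (rule bounded_op_eqI)
  fix \<xi>
  define \<zeta> where "\<zeta> = op_apply (L y) \<xi>"
  have Ladd: "L (a + b) = L a + L b" if "a \<in> M" "b \<in> M" for a b
    using lin that by (auto simp: complex_linear_on_def)
  have LC: "L (c *\<^sub>C a) = c *\<^sub>C L a" if "a \<in> M" for a c
    using lin that by (auto simp: complex_linear_on_def)
  have Lsum: "L (\<Sum>k<n. a k) = (\<Sum>k<n. L (a k)) \<and> (\<Sum>k<n. a k) \<in> M" if "\<And>k. a k \<in> M" for a and n :: nat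
  proof (induction n)
    case 0
    have "L (0 + 0) = L 0 + L 0" by (rule Ladd[OF zero_mem zero_mem])
    then show ?case by (simp add: zero_mem)
  qed (use that in \<open>simp add: Ladd add_mem\<close>)
  have Le: "L e = 0" if "projection_in M e" for e
    using proj[OF that one_mem] L1 by simp
  obtain R where R: "R > 0" "\<And>v. norm (op_apply y v) \<le> norm v * R"
    using bounded_linear.pos_bounded[OF bounded_linear_op] by blast
  then have leR: "norm (op_apply y v) \<le> R * norm v" for v by (simp add: mult.commute)
  obtain q l where q: "\<And>n. projection_in M (q n)"
    and qcomm: "\<And>n b. b \<in> M \<Longrightarrow> is_adjoint b b \<Longrightarrow> b * y = y * b \<Longrightarrow> b * q n = q n * b"
    and qle: "\<And>n v. norm (op_apply ((y - complex_of_real (l n) *\<^sub>C 1) * q n) v) \<le> R / 2 ^ n * norm v"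
    and qSuc: "\<And>n. q (Suc n) * q n = q (Suc n)" and lSuc: "\<And>n. \<bar>l (Suc n) - l n\<bar> \<le> R / 2 ^ Suc n"
    and qbig: "\<And>n. (norm \<zeta>)\<^sup>2 \<le> 2 ^ n * (norm (op_apply (q n) \<zeta>))\<^sup>2"
    using bisection_sequence[OF y leR R(1), of \<zeta>] by metis
  note qM = projection_in_D(1)[OF q] and qq = projection_in_D(2)[OF q] and qadj = projection_in_D(3)[OF q]
  have qy: "y * q n = q n * y" for n using qcomm[OF y] by simp
  have qdown: "q (n + j) * q n = q (n + j)" for n j
    by (induction j) (simp add: qq, metis qSuc add_Suc_right mult.assoc)
  have qdown': "q m * q n = q m" "q n * q m = q m" if "n \<le> m" for m n
  proof -
    show "q m * q n = q m" using qdown[of n "m - n"] that by simp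
    then show "q n * q m = q m"
      using is_adjoint_unique[OF is_adjoint_mult[OF qadj qadj], of m n "q m"] qadj by simp
  qed
  define f where "f v n = (norm (op_apply (q n) v))\<^sup>2" for v n
  have fdiff: "(norm (op_apply (q n - q m) v))\<^sup>2 = f v n - f v m" if "n \<le> m" for m n v
  proof -
    have "op_apply (1 - q m) (op_apply (q n) v) = op_apply (q n - q m) v"
      using qdown'(1)[OF that] by (simp add: left_diff_distrib flip: op_apply_simps(4))
    moreover have "op_apply (q m) (op_apply (q n) v) = op_apply (q m) v"
      using qdown'(1)[OF that] by (simp flip: op_apply_simps(4))
    ultimately show ?thesis
      using norm_projection_split[OF qq qadj, of "op_apply (q n) v" m] by (simp add: f_def)
  qed
  have fdec: "f v m \<le> f v n" if "n \<le> m" for v m n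
    using fdiff[OF that, of v] by (metis diff_ge_0_iff_ge zero_le_power2)
  \<comment> \<open>The limit of \<open>q n \<zeta>\<close> lies in the kernel of \<open>y - lim l\<close>. It vanishes because the projection
    \<open>k\<close> onto this kernel satisfies \<open>k L y = L (k y) = (lim l) L k = 0\<close>, so that \<open>k \<zeta> = 0\<close>.\<close>
  have flim: "f \<zeta> \<longlonglongrightarrow> 0"
  proof -
    have "convergent l"
    proof -
      have "summable (\<lambda>n. R / 2 * (1 / 2) ^ n)" by (intro summable_mult summable_geometric) simp
      then have "summable (\<lambda>n. l (Suc n) - l n)"
        by (rule summable_comparison_test') (use lSuc in \<open>simp add: power_divide\<close>)
      then have "convergent (\<lambda>N. \<Sum>n<N. l (Suc n) - l n)" by (simp add: summable_iff_convergent)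
      then have "convergent (\<lambda>N. l N - l 0)" by (simp add: sum_lessThan_telescope)
      then show ?thesis by (simp add: convergent_diff_const_right_iff)
    qed
    then obtain l0 where l: "l \<longlonglongrightarrow> l0" by (auto simp: convergent_def)
    have "decseq (f \<zeta>)" using fdec by (simp add: decseq_def)
    then have "Cauchy (f \<zeta>)"
      using decseq_convergent[of "f \<zeta>" 0] by (metis LIMSEQ_imp_Cauchy f_def zero_le_power2)
    have "Cauchy (\<lambda>n. op_apply (q n) \<zeta>)"
    proof (rule metric_CauchyI)
      fix e :: real assume "0 < e"
      then obtain N where N: "\<And>m n. m \<ge> N \<Longrightarrow> n \<ge> N \<Longrightarrow> dist (f \<zeta> m) (f \<zeta> n) < e\<^sup>2"
        using metric_CauchyD[OF \<open>Cauchy (f \<zeta>)\<close>, of "e\<^sup>2"] by auto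
      have *: "dist (op_apply (q n) \<zeta>) (op_apply (q m) \<zeta>) < e" if "N \<le> n" "n \<le> m" for m n
      proof -
        have "(norm (op_apply (q n - q m) \<zeta>))\<^sup>2 < e\<^sup>2"
          unfolding fdiff[OF that(2)] using N[of n m] that by (simp add: dist_real_def)
        then have "norm (op_apply (q n - q m) \<zeta>) < e" using \<open>0 < e\<close> power_less_imp_less_base by fastforce
        then show ?thesis by (simp add: dist_norm op_apply_simps)
      qed
      show "\<exists>M. \<forall>m\<ge>M. \<forall>n\<ge>M. dist (op_apply (q m) \<zeta>) (op_apply (q n) \<zeta>) < e"
        using * by (metis dist_commute nle_le)
    qed
    then obtain \<omega> where \<omega>: "(\<lambda>n. op_apply (q n) \<zeta>) \<longlonglongrightarrow> \<omega>" using Cauchy_convergent convergent_def by blast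
    define x where "x = y - complex_of_real l0 *\<^sub>C 1"
    have x: "x \<in> M" "is_adjoint x x" unfolding x_def
      by (intro diff_mem y scaleC_mem one_mem) (intro is_adjoint_diff y is_adjoint_of_real is_adjoint_one)
    obtain k where k: "projection_in M k" "k * x = 0" "\<And>v. op_apply x v = 0 \<Longrightarrow> op_apply k v = v"
      using kernel_projection[OF x] by metis
    have ky: "k * y = complex_of_real l0 *\<^sub>C k" using k(2) by (simp add: x_def right_diff_distrib scaleC_mult)
    moreover have "is_adjoint (k * y) (y * k)" "is_adjoint (k * y) (complex_of_real l0 *\<^sub>C k)"
      using is_adjoint_mult[OF projection_in_D(3)[OF k(1)] y(2)] is_adjoint_of_real[OF projection_in_D(3)[OF k(1)]]
      by (simp_all add: ky)
    ultimately have kyc: "k * y = y * k" using is_adjoint_unique by metis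
    have kq: "k * q n = q n * k" for n by (rule qcomm[OF projection_in_D(1,3)[OF k(1)] kyc])
    have "k * L y = L (k * y)" by (rule proj[OF k(1) y(1), symmetric])
    also have "\<dots> = 0" unfolding ky by (simp add: LC[OF projection_in_D(1)[OF k(1)]] Le[OF k(1)] scaleC_zero_right)
    finally have k\<zeta>: "op_apply k \<zeta> = 0" unfolding \<zeta>_def by (metis op_apply_simps(4,5))
    have "(\<lambda>n. op_apply y (op_apply (q n) \<zeta>) - l n *\<^sub>R op_apply (q n) \<zeta>) \<longlonglongrightarrow> op_apply y \<omega> - l0 *\<^sub>R \<omega>"
      by (intro tendsto_intros tendsto_op \<omega> l)
    moreover have "(\<lambda>n. op_apply y (op_apply (q n) \<zeta>) - l n *\<^sub>R op_apply (q n) \<zeta>) \<longlonglongrightarrow> 0"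
    proof (rule Lim_null_comparison[OF always_eventually])
      show "\<forall>n. norm (op_apply y (op_apply (q n) \<zeta>) - l n *\<^sub>R op_apply (q n) \<zeta>) \<le> R * norm \<zeta> * (1/2) ^ n"
        using qle by (simp add: op_apply_simps(2,4,6) op_apply_of_real power_divide)
      have "(\<lambda>n. R * norm \<zeta> * (1/2) ^ n) \<longlonglongrightarrow> R * norm \<zeta> * 0" by (intro tendsto_intros LIMSEQ_power_zero) simp
      then show "(\<lambda>n. R * norm \<zeta> * (1/2) ^ n) \<longlonglongrightarrow> 0" by simp
    qed
    ultimately have "op_apply y \<omega> - l0 *\<^sub>R \<omega> = 0" using LIMSEQ_unique by blast
    then have "op_apply k \<omega> = \<omega>" by (intro k(3)) (simp add: x_def op_apply_simps(2,6) op_apply_of_real)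
    moreover have "(\<lambda>n. op_apply k (op_apply (q n) \<zeta>)) \<longlonglongrightarrow> op_apply k \<omega>" by (rule tendsto_op[OF \<omega>])
    moreover have "op_apply k (op_apply (q n) \<zeta>) = 0" for n
      using kq[of n] k\<zeta> by (metis op_apply_simps(4) op_zero)
    ultimately have "\<omega> = 0" by (simp add: LIMSEQ_const_iff)
    then have "(\<lambda>n. (norm (op_apply (q n) \<zeta>))\<^sup>2) \<longlonglongrightarrow> (norm (0 :: 'h))\<^sup>2" using \<omega> by (intro tendsto_intros) auto
    then show ?thesis by (simp add: f_def[abs_def])
  qed
  define a where "a n = complex_of_real ((3/2) ^ n) *\<^sub>C ((y - complex_of_real (l n) *\<^sub>C 1) * q n)" for n
  have aM: "a n \<in> M" for n unfolding a_def by (intro scaleC_mem mult_mem diff_mem y one_mem qM)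
  have "norm (op_apply (a n) v) \<le> R * (3/4) ^ n * norm v" for n v
  proof -
    have "norm (op_apply (a n) v) \<le> (3/2) ^ n * (R / 2 ^ n * norm v)"
      unfolding a_def op_apply_of_real using mult_left_mono[OF qle, of "(3/2) ^ n" n v] by simp
    also have "(3/2) ^ n * (R / 2 ^ n * norm v) = R * ((3/2) ^ n * (1/2) ^ n) * norm v" by (simp add: power_divide)
    also have "(3/2) ^ n * (1/2) ^ n = (3/4 :: real) ^ n" by (simp flip: power_mult_distrib)
    finally show ?thesis .
  qed
  moreover have "summable (\<lambda>n. R * (3/4 :: real) ^ n)" by (intro summable_mult summable_geometric) simp
  ultimately obtain w where w: "\<And>v. (\<lambda>n. op_apply (a n) v) sums op_apply w v"
    by (rule operator_series[where B = "\<lambda>n. R * (3/4) ^ n"]) (rule that)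
  have wM: "w \<in> M"
  proof (rule mem_if_commutes)
    fix b assume b: "\<And>a. a \<in> M \<Longrightarrow> b * a = a * b"
    show "b * w = w * b"
    proof (rule limit_commutes)
      show "(\<lambda>n. op_apply (\<Sum>k<n. a k) v) \<longlonglongrightarrow> op_apply w v" for v
        using w[of v] by (simp add: sums_def op_apply_sum)
      show "b * (\<Sum>k<n. a k) = (\<Sum>k<n. a k) * b" for n
        using b aM by (simp add: sum_distrib_left sum_distrib_right)
    qed
  qed
  define \<kappa> where "\<kappa> = op_apply (L w) \<xi>"
  have decr: "f \<zeta> n - f \<zeta> (Suc n) \<le> (4/9) ^ n * (f \<kappa> n - f \<kappa> (Suc n))" for n
  proof -
    define r where "r = q n - q (Suc n)"
    have r: "projection_in M r" unfolding projection_in_def r_def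
      using qM qq qadj qdown'[of n "Suc n"] by (simp add: diff_mem is_adjoint_diff algebra_simps)
    note rM = projection_in_D(1)[OF r]
    have rqk: "r * q k = (if k \<le> n then r else 0)" for k
      unfolding r_def left_diff_distrib using qdown'[of n k] qdown'[of k n] qdown'[of "Suc n" k] qdown'[of k "Suc n"] by auto
    have qr: "q k * r = r * q k" for k
      unfolding r_def left_diff_distrib right_diff_distrib using qdown' by (metis nle_le)
    have yr: "y * r = r * y" unfolding r_def using qy by (simp add: left_diff_distrib right_diff_distrib)
    have ra: "r * a k = (if k \<le> n then complex_of_real ((3/2) ^ k) *\<^sub>C (r * y - complex_of_real (l k) *\<^sub>C r) else 0)" for k
    proof -
      have "r * ((y - complex_of_real (l k) *\<^sub>C 1) * q k) = (y - complex_of_real (l k) *\<^sub>C 1) * (r * q k)"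
        using yr by (simp add: left_diff_distrib right_diff_distrib scaleC_mult) (metis mult.assoc)
      also have "\<dots> = (if k \<le> n then r * y - complex_of_real (l k) *\<^sub>C r else 0)"
        unfolding rqk using yr by (simp add: left_diff_distrib scaleC_mult scaleC_zero_right)
      finally show ?thesis by (simp only: a_def scaleC_mult) (simp add: scaleC_zero_right)
    qed
    have rw: "r * w = (\<Sum>k<Suc n. r * a k)"
    proof (rule bounded_op_eqI)
      fix v
      have "(\<lambda>k. op_apply r (op_apply (a k) v)) sums op_apply r (op_apply w v)"
        by (rule bounded_linear.sums[OF bounded_linear_op w])
      then have "(\<lambda>k. op_apply (r * a k) v) sums op_apply (r * w) v" by (simp only: op_apply_simps(4))
      moreover have "(\<lambda>k. op_apply (r * a k) v) sums (\<Sum>k<Suc n. op_apply (r * a k) v)"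
        by (rule sums_finite) (auto simp: ra op_apply_simps(5))
      ultimately show "op_apply (r * w) v = op_apply (\<Sum>k<Suc n. r * a k) v"
        unfolding op_apply_sum by (rule sums_unique2)
    qed
    have Lra: "L (r * a k) = complex_of_real ((3/2) ^ k) *\<^sub>C (r * L y)" if "k \<le> n" for k
    proof -
      have "r * y - complex_of_real (l k) *\<^sub>C r = r * y + (- complex_of_real (l k)) *\<^sub>C r" by (simp add: scaleC_minus_left)
      moreover have "L (r * y + (- complex_of_real (l k)) *\<^sub>C r) = r * L y"
        using rM y(1) by (simp add: Ladd LC mult_mem scaleC_mem proj[OF r] Le[OF r] scaleC_zero_right)
      moreover have "r * y + (- complex_of_real (l k)) *\<^sub>C r \<in> M" by (intro add_mem mult_mem scaleC_mem rM y)
      ultimately have "L (complex_of_real ((3/2) ^ k) *\<^sub>C (r * y - complex_of_real (l k) *\<^sub>C r)) = complex_of_real ((3/2) ^ k) *\<^sub>C (r * L y)"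
        using LC by metis
      then show ?thesis unfolding ra using that by (simp only: if_True)
    qed
    have "r * L w = L (r * w)" by (rule proj[OF r wM, symmetric])
    also have "\<dots> = (\<Sum>k<Suc n. L (r * a k))" unfolding rw by (rule conjunct1[OF Lsum]) (rule mult_mem[OF rM aM])
    also have "\<dots> = (\<Sum>k<Suc n. complex_of_real ((3/2) ^ k) *\<^sub>C (r * L y))" by (intro sum.cong) (auto simp: Lra)
    finally have "op_apply (r * L w) \<xi> = (\<Sum>k<Suc n. (3/2) ^ k *\<^sub>R op_apply (r * L y) \<xi>)"
      by (simp only: op_apply_sum op_apply_of_real)
    then have "op_apply r \<kappa> = (\<Sum>k<Suc n. (3/2) ^ k) *\<^sub>R op_apply r \<zeta>"
      by (simp only: \<kappa>_def \<zeta>_def op_apply_simps(4) scaleR_sum_left)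
    then have "norm (op_apply r \<kappa>) = \<bar>\<Sum>k<Suc n. (3/2) ^ k\<bar> * norm (op_apply r \<zeta>)" by simp
    moreover have "(3/2) ^ n \<le> \<bar>\<Sum>k<Suc n. (3/2 :: real) ^ k\<bar>"
      by (rule order_trans[OF _ abs_ge_self]) (rule member_le_sum, auto)
    ultimately have "(3/2) ^ n * norm (op_apply r \<zeta>) \<le> norm (op_apply r \<kappa>)"
      by (simp add: mult_right_mono)
    then have "((3/2) ^ n * norm (op_apply r \<zeta>))\<^sup>2 \<le> (norm (op_apply r \<kappa>))\<^sup>2" by (rule power_mono) simp
    moreover have "((3/2) ^ n * norm (op_apply r \<zeta>))\<^sup>2 = (9/4) ^ n * (norm (op_apply r \<zeta>))\<^sup>2"
    proof -
      have "((3/2 :: real) ^ n)\<^sup>2 = ((3/2)\<^sup>2) ^ n" by (simp only: mult.commute flip: power_mult)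
      also have "(3/2 :: real)\<^sup>2 = 9/4" by (simp add: power2_eq_square)
      finally show ?thesis by (simp only: power_mult_distrib)
    qed
    ultimately have "(4/9) ^ n * ((9/4) ^ n * (norm (op_apply r \<zeta>))\<^sup>2) \<le> (4/9) ^ n * (norm (op_apply r \<kappa>))\<^sup>2"
      by (intro mult_left_mono) auto
    moreover have "(4/9) ^ n * ((9/4) ^ n * t) = t" for t :: real
      by (simp flip: power_mult_distrib mult.assoc)
    ultimately have "(norm (op_apply r \<zeta>))\<^sup>2 \<le> (4/9) ^ n * (norm (op_apply r \<kappa>))\<^sup>2" by simp
    then show ?thesis unfolding r_def by (simp only: fdiff[of n "Suc n"] le_SucI order_refl)
  qed
  have bound: "f \<zeta> n \<le> (4/9) ^ n * f \<kappa> 0" for n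
    by (rule bounded_by_scaled_decrements[OF decr fdec _ _ _ flim]) (auto simp: f_def)
  have "(norm \<zeta>)\<^sup>2 \<le> (8/9) ^ n * f \<kappa> 0" for n
  proof -
    have "(norm \<zeta>)\<^sup>2 \<le> 2 ^ n * f \<zeta> n" using qbig[of n] by (simp add: f_def)
    also have "\<dots> \<le> 2 ^ n * ((4/9) ^ n * f \<kappa> 0)" by (intro mult_left_mono bound) simp
    also have "\<dots> = (8/9) ^ n * f \<kappa> 0" by (simp flip: power_mult_distrib mult.assoc)
    finally show ?thesis .
  qed
  moreover have "(\<lambda>n. (8/9 :: real) ^ n * f \<kappa> 0) \<longlonglongrightarrow> 0 * f \<kappa> 0"
    by (intro tendsto_intros LIMSEQ_power_zero) simp
  ultimately have "(norm \<zeta>)\<^sup>2 \<le> 0"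
    using LIMSEQ_le_const[of "\<lambda>n. (8/9 :: real) ^ n * f \<kappa> 0" 0 "(norm \<zeta>)\<^sup>2"] by simp
  then show "op_apply (L y) \<xi> = op_apply 0 \<xi>" by (simp add: \<zeta>_def op_apply_simps(5))
qed

text \<open>Subtracting \<open>a \<mapsto> a * L 1\<close> reduces to maps vanishing at \<open>1\<close>, and real and imaginary parts
  reduce to self-adjoint elements.\<close>
lemma projection_linear_is_right_multiplication:
  assumes lin: "complex_linear_on M L" and proj: "\<And>e x. projection_in M e \<Longrightarrow> x \<in> M \<Longrightarrow> L (e * x) = e * L x"
    and x: "x \<in> M"
  shows "L x = x * L 1"
proof -
  define S where "S a = L a - a * L 1" for a
  have S: "complex_linear_on M S"
    using lin by (simp add: complex_linear_on_def S_def algebra_simps scaleC_mult scaleC_diff_right)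
  have "S (e * a) = e * S a" if "projection_in M e" "a \<in> M" for e a
    using proj[OF that] by (simp add: S_def algebra_simps)
  then have sa: "S a = 0" if "a \<in> M" "is_adjoint a a" for a
    using projection_linear_selfadjoint[OF S _ _ that] by (simp add: S_def)
  obtain b where b: "b \<in> M" "is_adjoint x b" using adjoint_mem[OF x] by blast
  define h where "h = x + b"
  define g where "g = \<i> *\<^sub>C (b - x)"
  have h: "h \<in> M" "is_adjoint h h"
    using x b is_adjoint_add[OF b(2) is_adjoint_sym[OF b(2)]] by (simp_all add: h_def add_mem add.commute)
  have gM: "g \<in> M" unfolding g_def by (intro scaleC_mem diff_mem x b)
  have "is_adjoint g (cnj \<i> *\<^sub>C (x - b))"
    unfolding g_def by (intro is_adjoint_scaleC is_adjoint_diff b is_adjoint_sym[OF b(2)])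
  also have "cnj \<i> *\<^sub>C (x - b) = g" by (simp add: g_def scaleC_minus_left scaleC_diff_right)
  finally have g: "is_adjoint g g" .
  have "S (h + \<i> *\<^sub>C g) = 0"
    using S sa[OF h] sa[OF gM g] h(1) gM scaleC_mem[OF gM] by (simp add: complex_linear_on_def scaleC_zero_right)
  moreover have "h + \<i> *\<^sub>C g = 2 *\<^sub>C x"
    using scaleC_add_left[of 1 1 x] by (simp add: h_def g_def scaleC_scaleC scaleC_minus_left scaleC_one scaleC_diff_right)
  ultimately have "2 *\<^sub>C S x = 0" using S x by (simp add: complex_linear_on_def)
  then have "(1/2) *\<^sub>C 2 *\<^sub>C S x = 0" by (simp only: scaleC_zero_right)
  then have "S x = 0" by (simp add: scaleC_scaleC scaleC_one)
  then show ?thesis by (simp add: S_def)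
qed

section \<open>The action of an anti-derivable map on idempotents\<close>
lemma semiprime:
  assumes u: "u \<in> M" and "\<And>x. x \<in> M \<Longrightarrow> u * x * u = 0" shows "u = 0"
proof -
  obtain v where v: "v \<in> M" "is_adjoint u v" using adjoint_mem[OF u] by blast
  have "(v * u) * (v * u) = v * (u * v * u)" by (simp add: mult.assoc)
  then have "v * u = 0"
    using adjoint_square_zero[OF is_adjoint_mult[OF is_adjoint_sym[OF v(2)] v(2)]] assms(2)[OF v(1)] by simp
  then show ?thesis by (rule adjoint_square_zero[OF v(2)])
qed

lemma anti_derivable_corner:
  assumes T: "anti_derivable_at_zero M T"
    and g: "g \<in> M" "g * g = g" and xy: "x \<in> M" "y \<in> M"
  shows "T ((1 - g) * y) * (x * g) + (1 - g) * y * T (x * g) = 0"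
proof -
  have "x * g * ((1 - g) * y) = x * (g * (1 - g)) * y" by (simp only: mult.assoc)
  then have "x * g * ((1 - g) * y) = 0" using g(2) by (simp add: right_diff_distrib)
  moreover have "x * g \<in> M" "(1 - g) * y \<in> M" by (intro mult_mem diff_mem one_mem g xy)+
  ultimately show ?thesis using T by (simp add: anti_derivable_at_zero_def)
qed

text \<open>With \<open>h = 1 - g\<close>, the products \<open>(x g) (h y)\<close> and \<open>(x h) (g y)\<close> vanish. The choice \<open>x = y = 1\<close> shows that
  \<open>T 1\<close> commutes with \<open>g\<close> and determines the diagonal corners of \<open>T g\<close>; varying \<open>x\<close> and \<open>y\<close> shows that the
  off-diagonal corners \<open>u\<close> of \<open>T g\<close> satisfy \<open>u M u = 0\<close>.\<close>
lemma anti_derivable_idempotent: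
  assumes T: "T \<in> M \<rightarrow> M" "complex_linear_on M T" "anti_derivable_at_zero M T"
    and g: "g \<in> M" "g * g = g"
  shows "T 1 * g = g * T 1" "T g = T 1 * g"
proof -
  define h where "h = 1 - g"
  define \<delta> where "\<delta> = T 1"
  have h: "h \<in> M" "h * h = h" using g by (simp_all add: h_def diff_mem one_mem algebra_simps)
  have gh: "g * h = 0" "h * g = 0" "g + h = 1" "1 - h = g" using g(2) by (simp_all add: h_def algebra_simps)
  have TM: "T a \<in> M" if "a \<in> M" for a using T(1) that by blast
  have "T (g + h) = T g + T h" using T(2) g h by (simp add: complex_linear_on_def)
  then have Th: "T h = \<delta> - T g" by (simp add: gh \<delta>_def)
  have c1: "T (h * y) * (x * g) + h * y * T (x * g) = 0" if "x \<in> M" "y \<in> M" for x y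
    using anti_derivable_corner[OF T(3) g that] by (simp add: h_def)
  have c2: "T (g * y) * (x * h) + g * y * T (x * h) = 0" if "x \<in> M" "y \<in> M" for x y
    using anti_derivable_corner[OF T(3) h that] by (simp add: gh)
  have hg: "(\<delta> - T g) * g + h * T g = 0" using c1[OF one_mem one_mem] by (simp add: Th)
  have gg: "T g * h + g * (\<delta> - T g) = 0" using c2[OF one_mem one_mem] by (simp add: Th)
  have "\<delta> * g - T g * g + T g - g * T g = 0" using hg by (simp add: h_def algebra_simps)
  moreover have "T g - T g * g + g * \<delta> - g * T g = 0" using gg by (simp add: h_def algebra_simps)
  ultimately have "\<delta> * g - g * \<delta> = 0" by (metis (no_types, lifting) add.commute add_diff_cancel_left' add_diff_eq diff_diff_eq2 eq_iff_diff_eq_0)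
  then have dg: "\<delta> * g = g * \<delta>" by simp
  then show "T 1 * g = g * T 1" by (simp add: \<delta>_def)
  have dh: "\<delta> * h = h * \<delta>" using dg by (simp add: h_def algebra_simps)
  have hh: "h * T g * h = 0"
  proof -
    have "((\<delta> - T g) * g + h * T g) * h = (\<delta> - T g) * (g * h) + h * T g * h" by (simp add: distrib_right mult.assoc)
    then show ?thesis using hg gh by simp
  qed
  have ggg: "g * T g * g = g * \<delta>"
  proof -
    have "(T g * h + g * (\<delta> - T g)) * g = T g * (h * g) + g * (\<delta> * g) - g * T g * g"
      by (simp add: algebra_simps)
    then show ?thesis using gg gh dg g(2) by (simp flip: mult.assoc)
  qed
  have u0: "h * y * T g * h = 0" if "y \<in> M" for y
  proof -
    have "(T (h * y) * g + h * y * T g) * h = T (h * y) * (g * h) + h * y * T g * h"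
      by (simp add: distrib_right mult.assoc)
    then show ?thesis using c1[OF one_mem that] gh by simp
  qed
  have v0: "h * T g * x * h = 0" if "x \<in> M" for x
  proof -
    have "h * (T g * (x * h) + g * T (x * h)) = h * T g * x * h + (h * g) * T (x * h)"
      by (simp add: distrib_left mult.assoc)
    then show ?thesis using c2[OF that one_mem] gh by simp
  qed
  have gTh: "g * T g * h = 0"
  proof (rule semiprime)
    fix x assume "x \<in> M"
    then have "h * (x * g) * T g * h = 0" by (intro u0 mult_mem g)
    moreover have "g * T g * h * x * (g * T g * h) = g * T g * (h * (x * g) * T g * h)" by (simp only: mult.assoc)
    ultimately show "g * T g * h * x * (g * T g * h) = 0" by simp
  qed (intro mult_mem g h TM)
  have hTg: "h * T g * g = 0"
  proof (rule semiprime)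
    fix x assume "x \<in> M"
    then have "h * T g * (g * x) * h = 0" by (intro v0 mult_mem g)
    moreover have "h * T g * g * x * (h * T g * g) = (h * T g * (g * x) * h) * (T g * g)" by (simp only: mult.assoc)
    ultimately show "h * T g * g * x * (h * T g * g) = 0" by simp
  qed (intro mult_mem g h TM)
  have "T g = (g + h) * T g * (g + h)" by (simp add: gh)
  also have "\<dots> = g * T g * g + g * T g * h + h * T g * g + h * T g * h" by (simp add: distrib_left distrib_right add.assoc)
  also have "\<dots> = g * \<delta>" by (simp add: ggg gTh hTg hh)
  finally show "T g = T 1 * g" by (simp add: dg flip: \<delta>_def)
qed

text \<open>Idempotents that are not self-adjoint are needed here: \<open>e + z\<close> is one for \<open>z = e x (1 - e)\<close>, so
  \<open>T z = T 1 z\<close> and \<open>T 1\<close> commutes with \<open>z\<close>. On the other hand \<open>(1 - e) z = 0\<close> is a zero product and yields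
  \<open>T z (1 - e) = - z T 1\<close>. The two signs are compatible only if \<open>T 1 z = 0\<close>.\<close>
lemma anti_derivable_off_diagonal:
  assumes T: "T \<in> M \<rightarrow> M" "complex_linear_on M T" "anti_derivable_at_zero M T"
    and e: "projection_in M e" and x: "x \<in> M"
  shows "T (e * x * (1 - e)) = 0" "T 1 * (e * x * (1 - e)) = 0" "(1 - e) * T (e * x * e) = 0"
proof -
  define h where "h = 1 - e"
  define z where "z = e * x * h"
  note eD = projection_in_D(1,2)[OF e]
  have h: "h \<in> M" "h * h = h" using eD by (simp_all add: h_def diff_mem one_mem algebra_simps)
  have eh: "e * h = 0" "h * e = 0" "1 - h = e" using eD by (simp_all add: h_def algebra_simps)
  have zM: "z \<in> M" unfolding z_def by (intro mult_mem eD h x)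
  have ez: "e * z = z" "z * h = z" unfolding z_def using eD(2) h(2) by (metis mult.assoc)+
  have ze: "z * e = 0" unfolding z_def using eh(2) by (simp add: mult.assoc)
  have zz: "z * z = 0" using ez(1) ze by (metis mult.assoc mult_zero_left)
  have idem: "(e + z) * (e + z) = e + z" using eD(2) ez ze zz by (simp add: distrib_left distrib_right)
  have ezM: "e + z \<in> M" using eD zM by (simp add: add_mem)
  note on_idem = anti_derivable_idempotent[OF T]
  have "T (e + z) = T e + T z" using T(2) eD zM by (simp add: complex_linear_on_def)
  then have Tz: "T z = T 1 * z" using on_idem(2)[OF ezM idem] on_idem(2)[OF eD] by (simp add: distrib_left)
  have dz: "T 1 * z = z * T 1" using on_idem(1)[OF ezM idem] on_idem(1)[OF eD] by (simp add: distrib_left distrib_right)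
  have "T (e * z) * (1 * h) + e * z * T (1 * h) = 0"
    using anti_derivable_corner[OF T(3) h one_mem zM] by (simp add: eh)
  then have "T z * h + z * (T 1 * h) = 0" using ez(1) on_idem(2)[OF h] by simp
  moreover have "T z * h = T 1 * z" using Tz ez(2) by (simp add: mult.assoc)
  moreover have "z * (T 1 * h) = T 1 * z" using on_idem(1)[OF h] ez(2) dz by (metis mult.assoc)
  ultimately have "2 *\<^sub>C (T 1 * z) = 0" using scaleC_add_left[of 1 1 "T 1 * z"] by (simp add: scaleC_one)
  then have "(1/2) *\<^sub>C 2 *\<^sub>C (T 1 * z) = 0" by (simp only: scaleC_zero_right)
  then have 0: "T 1 * z = 0" by (simp add: scaleC_scaleC scaleC_one)
  then show "T (e * x * (1 - e)) = 0" "T 1 * (e * x * (1 - e)) = 0" using Tz by (simp_all add: z_def h_def)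
  have "T (h * 1) * (e * x * e) + h * 1 * T (e * x * e) = 0"
    using anti_derivable_corner[OF T(3) eD, of "e * x" 1] mult_mem[OF eD(1) x] one_mem by (simp add: h_def)
  moreover have "T h * (e * x * e) = T 1 * (h * e) * x * e" using on_idem(2)[OF h] by (simp add: mult.assoc)
  ultimately show "(1 - e) * T (e * x * e) = 0" using eh(2) by (simp add: h_def)
qed

lemma anti_derivable_projection:
  assumes T: "T \<in> M \<rightarrow> M" "complex_linear_on M T" "anti_derivable_at_zero M T"
    and e: "projection_in M e" and x: "x \<in> M"
  shows "T (e * x) = e * T x" "T 1 * (e * x) = T 1 * (x * e)"
proof -
  define h where "h = 1 - e"
  have h: "projection_in M h" unfolding h_def by (rule projection_in_complement[OF e])
  note eD = projection_in_D(1,2)[OF e] and hD = projection_in_D(1,2)[OF h]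
  have he: "1 - h = e" "e + h = 1" by (simp_all add: h_def)
  note off = anti_derivable_off_diagonal[OF T e x, folded h_def]
    and off' = anti_derivable_off_diagonal[OF T h x, unfolded he(1)]
  have Tadd: "T (a + b) = T a + T b" if "a \<in> M" "b \<in> M" for a b
    using T(2) that by (simp add: complex_linear_on_def)
  have mem: "e * x * e \<in> M" "e * x * h \<in> M" "h * x * e \<in> M" "h * x * h \<in> M"
    by (intro mult_mem eD hD x)+
  have ex: "e * x = e * x * e + e * x * h" and hx: "h * x = h * x * e + h * x * h" and xe: "x * e = e * x * e + h * x * e"
    by (simp_all add: h_def algebra_simps)
  have Tex: "T (e * x) = T (e * x * e)" by (subst ex) (simp add: Tadd mem off)
  have Thx: "T (h * x) = T (h * x * h)" by (subst hx) (simp add: Tadd mem off')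
  have "x = e * x + h * x" by (simp add: h_def algebra_simps)
  then have "T x = T (e * x) + T (h * x)" using Tadd mult_mem eD hD x by metis
  then have "e * T x = e * T (e * x * e) + e * T (h * x * h)" by (simp add: Tex Thx distrib_left)
  also have "\<dots> = (e + h) * T (e * x * e)" using off(3) off'(3) by (simp add: distrib_right)
  finally show "T (e * x) = e * T x" by (simp add: he Tex)
  show "T 1 * (e * x) = T 1 * (x * e)"
    by (subst ex, subst xe) (simp add: distrib_left off(2) off'(2))
qed

text \<open>The maps \<open>T\<close>, \<open>a \<mapsto> T 1 * a\<close> and \<open>a \<mapsto> T 1 * (a * y - y * a)\<close> are all compatible with left
  multiplication by projections, so each of them is a right multiplication by its value at \<open>1\<close>.\<close>
lemma anti_derivable_imp_multiplication:
  assumes T: "T \<in> M \<rightarrow> M" "complex_linear_on M T" "anti_derivable_at_zero M T"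
    and x: "x \<in> M"
  shows "T x = x * T 1" "T 1 * x = x * T 1" "y \<in> M \<Longrightarrow> T 1 * (x * y - y * x) = 0"
proof -
  note proj = anti_derivable_projection[OF T]
  show "T x = x * T 1"
    by (rule projection_linear_is_right_multiplication[OF T(2) _ x]) (rule proj(1))
  define L where "L a = T 1 * a" for a
  have lin: "complex_linear_on M L" by (simp add: complex_linear_on_def L_def distrib_left scaleC_mult)
  have de: "T 1 * e = e * T 1" if "projection_in M e" for e
    using anti_derivable_idempotent(1)[OF T projection_in_D(1,2)[OF that]] .
  have "L x = x * L 1"
  proof (rule projection_linear_is_right_multiplication[OF lin _ x])
    show "L (e * a) = e * L a" if "projection_in M e" for e a
      using de[OF that] by (simp add: L_def flip: mult.assoc)
  qed
  then show "T 1 * x = x * T 1" by (simp add: L_def)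
  show "T 1 * (x * y - y * x) = 0" if y: "y \<in> M"
  proof -
    define K where "K a = T 1 * (a * y - y * a)" for a
    have lin: "complex_linear_on M K"
      by (simp add: complex_linear_on_def K_def algebra_simps scaleC_mult scaleC_diff_right)
    have "K x = x * K 1"
    proof (rule projection_linear_is_right_multiplication[OF lin _ x])
      fix e a assume e: "projection_in M e" and a: "a \<in> M"
      have "T 1 * (y * e * a) = T 1 * (e * y * a)"
        using proj(2)[OF e y] by (metis mult.assoc)
      moreover have "T 1 * (e * t) = e * (T 1 * t)" for t using de[OF e] by (metis mult.assoc)
      ultimately show "K (e * a) = e * K a" by (simp add: K_def right_diff_distrib mult.assoc)
    qed
    then show ?thesis by (simp add: K_def)
  qed
qed

section \<open>The type \<open>I\<^sub>1\<close> summand\<close>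

text \<open>For \<open>n = 1\<close> the sum has a single term, so \<open>p\<close> itself is the abelian projection.\<close>
lemma type_I_summand_1_iff:
  "type_I_summand M 1 p \<longleftrightarrow> central_projection M p \<and> (\<forall>a\<in>M. \<forall>b\<in>M. p * (a * b - b * a) = 0)"
proof (cases "central_projection M p")
  case True
  then have pM: "p \<in> M" and pp: "p * p = p" and padj: "is_adjoint p p" and c: "\<And>a. a \<in> M \<Longrightarrow> p * a = a * p"
    by (auto simp: central_projection_def projection_in_def)
  have eq: "(p * a * p) * (p * b * p) = p * (a * b)" if "a \<in> M" "b \<in> M" for a b
    using c[OF that(1)] c[OF that(2)] pp by (metis mult.assoc)
  have "abelian_projection M p \<longleftrightarrow> (\<forall>a\<in>M. \<forall>b\<in>M. p * (a * b - b * a) = 0)"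
    using True eq by (simp add: abelian_projection_def central_projection_def right_diff_distrib)
  moreover have "mvn_equivalent M p p" unfolding mvn_equivalent_def using pM pp padj by blast
  moreover have "type_I_summand M 1 p \<longleftrightarrow> abelian_projection M p \<and> mvn_equivalent M p p"
    using True by (auto simp: type_I_summand_def intro!: exI[of _ "\<lambda>_. p"])
  ultimately show ?thesis using True by simp
qed (simp add: type_I_summand_def)

text \<open>The complement of the greatest commutative summand is generated by the commutators: its unit \<open>N\<close>
  is the range projection of the set \<open>A\<close> of their left multiples. A central element \<open>c\<close> killing all
  commutators kills \<open>N\<close>, and hence belongs to the summand with unit \<open>1 - N\<close>.\<close>
lemma greatest_commutative_summand:
  shows "type_I_summand M 1 (type_I_projection M 1)"
    and "c \<in> M \<Longrightarrow> (\<And>a. a \<in> M \<Longrightarrow> c * a = a * c) \<Longrightarrow> (\<And>a b. a \<in> M \<Longrightarrow> b \<in> M \<Longrightarrow> c * (a * b - b * a) = 0)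
      \<Longrightarrow> type_I_projection M 1 * c = c"
proof -
  define A where "A = {c * (a * b - b * a) | a b c. a \<in> M \<and> b \<in> M \<and> c \<in> M}"
  have "A \<subseteq> M" by (auto simp: A_def intro!: mult_mem diff_mem)
  then obtain N where N: "projection_in M N" and NA: "\<forall>a\<in>A. N * a = a" 
    and N0: "\<forall>c. (\<forall>a\<in>A. c * a = 0) \<longrightarrow> c * N = 0"
    by (rule range_projection)
  note ND = projection_in_D[OF N]
  \<comment> \<open>The set \<open>A\<close> is stable under left multiplication by \<open>M\<close>, hence so is the range of \<open>N\<close>; taking
    adjoints, \<open>N\<close> is central.\<close>
  have inv: "b * N = N * b * N" if "b \<in> M" for b
  proof -
    have "(b - N * b) * a = 0" if "a \<in> A" for a
    proof -
      obtain x y c where xyc: "a = c * (x * y - y * x)" "x \<in> M" "y \<in> M" "c \<in> M" using \<open>a \<in> A\<close> by (auto simp: A_def)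
      then have "b * a = (b * c) * (x * y - y * x)" by (simp only: mult.assoc)
      moreover have "b * c \<in> M" using \<open>b \<in> M\<close> xyc(4) by (rule mult_mem)
      ultimately have "b * a \<in> A" using xyc(2,3) unfolding A_def by blast
      then show ?thesis using NA by (simp add: left_diff_distrib mult.assoc)
    qed
    then have "(b - N * b) * N = 0" using N0 by blast
    then show ?thesis by (simp add: left_diff_distrib)
  qed
  have cen: "N * b = b * N" if b: "b \<in> M" for b
  proof -
    obtain d where d: "d \<in> M" "is_adjoint b d" using adjoint_mem[OF b] by blast
    note db = is_adjoint_sym[OF d(2)]
    have "is_adjoint (d * N) (N * b)" by (rule is_adjoint_mult[OF db ND(3)])
    moreover have "is_adjoint (N * d * N) (N * (b * N))"
      by (rule is_adjoint_mult[OF is_adjoint_mult[OF ND(3) db] ND(3)])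
    ultimately have "N * b = N * (b * N)" unfolding inv[OF d(1), symmetric] by (rule is_adjoint_unique)
    also have "\<dots> = b * N" using inv[OF b] by (simp only: mult.assoc)
    finally show ?thesis .
  qed
  define p where "p = 1 - N"
  have p: "type_I_summand M 1 p" unfolding type_I_summand_1_iff
  proof (intro conjI ballI)
    show "central_projection M p" unfolding central_projection_def p_def
      using projection_in_complement[OF N] cen by (simp add: left_diff_distrib right_diff_distrib)
    fix a b assume "a \<in> M" "b \<in> M"
    then have "1 * (a * b - b * a) \<in> A" unfolding A_def using one_mem by blast
    then show "p * (a * b - b * a) = 0" using NA by (simp add: p_def left_diff_distrib)
  qed
  have pc: "p * c = c" if "c \<in> M" and c: "\<And>a. a \<in> M \<Longrightarrow> c * a = a * c"
    and c0: "\<And>a b. a \<in> M \<Longrightarrow> b \<in> M \<Longrightarrow> c * (a * b - b * a) = 0" for c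
  proof -
    have "c * t = 0" if "t \<in> A" for t
    proof -
      obtain x y d where t: "t = d * (x * y - y * x)" "x \<in> M" "y \<in> M" "d \<in> M" using \<open>t \<in> A\<close> by (auto simp: A_def)
      then have "c * t = d * (c * (x * y - y * x))" using c[OF t(4)] by (metis mult.assoc)
      then show ?thesis using c0[OF t(2,3)] by simp
    qed
    then have "c * N = 0" using N0 by blast
    then show ?thesis using cen[OF \<open>c \<in> M\<close>] by (simp add: p_def left_diff_distrib)
  qed
  have greatest: "p * r = r" if "type_I_summand M 1 r" for r
    using that unfolding type_I_summand_1_iff central_projection_def projection_in_def by (intro pc) auto
  have "type_I_projection M 1 = p" unfolding type_I_projection_def
  proof (rule the_equality)
    show "type_I_summand M 1 p \<and> (\<forall>r. type_I_summand M 1 r \<longrightarrow> p * r = r)" using p greatest by blast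
    fix r assume r: "type_I_summand M 1 r \<and> (\<forall>s. type_I_summand M 1 s \<longrightarrow> r * s = s)"
    then have "r * p = p" "p * r = r" using p greatest by blast+
    moreover have "p * r = r * p"
      using p r unfolding type_I_summand_1_iff central_projection_def projection_in_def by blast
    ultimately show "r = p" by simp
  qed
  then show "type_I_summand M 1 (type_I_projection M 1)"
    and "c \<in> M \<Longrightarrow> (\<And>a. a \<in> M \<Longrightarrow> c * a = a * c) \<Longrightarrow> (\<And>a b. a \<in> M \<Longrightarrow> b \<in> M \<Longrightarrow> c * (a * b - b * a) = 0)
      \<Longrightarrow> type_I_projection M 1 * c = c"
    using p pc by blast+
qed

end

theorem corollary3p2:
  fixes M :: "'h::complex_hilbert bounded_op set"
    and T :: "'h bounded_op \<Rightarrow> 'h bounded_op"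
  assumes "von_neumann_algebra M"
    and "T \<in> M \<rightarrow> M"
    and "complex_linear_on M T"
  shows "anti_derivable_at_zero M T \<longleftrightarrow>
    (\<exists>\<eta>\<in>type_I_part M 1. \<forall>a\<in>M. T a = \<eta> * a)"
proof -
  interpret vn_algebra M by standard (rule assms(1))
  define p where "p = type_I_projection M 1"
  have p: "\<And>a. a \<in> M \<Longrightarrow> p * a = a * p" "\<And>a b. a \<in> M \<Longrightarrow> b \<in> M \<Longrightarrow> p * (a * b - b * a) = 0"
    using greatest_commutative_summand(1) unfolding type_I_summand_1_iff p_def central_projection_def by blast+
  show ?thesis
  proof
    assume ad: "anti_derivable_at_zero M T"
    note T = anti_derivable_imp_multiplication[OF assms(2,3) ad]
    have d: "T 1 \<in> M" using assms(2) one_mem by blast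
    have "p * T 1 = T 1" unfolding p_def
      by (rule greatest_commutative_summand(2)[OF d]) (use T in auto)
    then have "T 1 \<in> type_I_part M 1" unfolding type_I_part_def p_def[symmetric] using d by force
    moreover have "T a = T 1 * a" if "a \<in> M" for a using T(1,2)[OF that] by simp
    ultimately show "\<exists>\<eta>\<in>type_I_part M 1. \<forall>a\<in>M. T a = \<eta> * a" by blast
  next
    assume "\<exists>\<eta>\<in>type_I_part M 1. \<forall>a\<in>M. T a = \<eta> * a"
    then obtain c where c: "c \<in> M" and T: "\<And>a. a \<in> M \<Longrightarrow> T a = p * c * a"
      by (auto simp: type_I_part_def p_def)
    have comm: "p * (a * b) = p * (b * a)" if "a \<in> M" "b \<in> M" for a b
      using p(2)[OF that] by (simp add: right_diff_distrib)
    show "anti_derivable_at_zero M T" unfolding anti_derivable_at_zero_def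
    proof (intro ballI impI)
      fix a b assume a: "a \<in> M" and b: "b \<in> M" and ab: "a * b = 0"
      have ba: "p * (b * a) = 0" using comm[OF a b] ab by simp
      have "T b * a = p * (c * (b * a))" using T[OF b] by (simp add: mult.assoc)
      also have "\<dots> = p * (b * a) * c" using comm[OF c mult_mem[OF b a]] by (simp add: mult.assoc)
      finally have 1: "T b * a = 0" by (simp add: ba)
      have "b * T a = b * p * (c * a)" using T[OF a] by (simp add: mult.assoc)
      also have "\<dots> = b * (p * (a * c))" using comm[OF c a] by (simp add: mult.assoc)
      also have "\<dots> = p * (b * a) * c" using p(1)[OF b] by (metis mult.assoc)
      finally show "T b * a + b * T a = 0" using 1 by (simp add: ba)
    qed
  qed
qed

end
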